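(* Let $f\in\mathcal F$ and let $g(\lambda)=h(\lambda)|q(\lambda)|^\alpha$, $\lambda\in\Lambda$, where $\alpha\in\mathbb R$, $h\in B_+^-$, $q$ is an algebraic polynomial with real coefficients, not identically zero, and $fg\in L^1(\Lambda)$. Then $fg\in\mathcal F$ and $g\in\mathcal M_f$; in particular $\lim_{n\to\infty}\sigma_n^2(fg)/\sigma_n^2(f)=G(g)$.
   Context: $\Lambda=[-\pi,\pi]$. $G(h)=\exp\{\frac1{2\pi}\int_\Lambda\ln h\,d\lambda\}$ if $\ln h\in L^1(\Lambda)$, else $0$. $\sigma_n^2(f)=\min_{c_1,\dots,c_n\in\mathbb C}\int_\Lambda|1-\sum_{k=1}^n c_ke^{-ik\lambda}|^2f(\lambda)\,d\lambda$, $\sigma_n(f)=\sqrt{\sigma_n^2(f)}$. $\mathcal F=\{f\in L^1(\Lambda): f\ge0,\ G(f)=0,\ \lim_{n}\sigma_{n+1}(f)/\sigma_n(f)=1\}$. For $f\in\mathcal F$, $\mathcal M_f=\{g\ge0: G(g)>0,\ fg\in L^1(\Lambda),\ \lim_{n}\sigma_n^2(fg)/\sigma_n^2(f)=G(g)\}$. $B$ = nonnegative Riemann integrable functions on $\Lambda$; $B_+^-=\{h\in B: m\le h\le M\text{ for some constants }0<m\le M\}$. *)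

theory Defs
  imports "HOL-Analysis.Analysis" "HOL-Computational_Algebra.Polynomial"
begin

definition Lam :: "real set" where "Lam = {-pi..pi}"

definition L1 :: "(real \<Rightarrow> real) \<Rightarrow> bool" where
  "L1 f \<longleftrightarrow> f absolutely_integrable_on Lam"

text \<open>ln h in L^1: since ln 0 = -infinity, this requires h > 0 a.e. and integrability of ln h.\<close>
definition lnL1 :: "(real \<Rightarrow> real) \<Rightarrow> bool" where
  "lnL1 h \<longleftrightarrow> {x \<in> Lam. h x \<le> 0} \<in> null_sets lebesgue \<and>
              (\<lambda>x. ln (h x)) absolutely_integrable_on Lam"

definition G :: "(real \<Rightarrow> real) \<Rightarrow> real" where
  "G h = (if lnL1 h then exp (1 / (2 * pi) * integral Lam (\<lambda>x. ln (h x))) else 0)"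

definition sigma2 :: "(real \<Rightarrow> real) \<Rightarrow> nat \<Rightarrow> real" where
  "sigma2 f n = Inf {integral Lam (\<lambda>l. (cmod (1 - (\<Sum>k=1..n. c k * exp (- \<i> * of_nat k * of_real l))))\<^sup>2 * f l)
                     | c :: nat \<Rightarrow> complex. True}"

definition sigma :: "(real \<Rightarrow> real) \<Rightarrow> nat \<Rightarrow> real" where
  "sigma f n = sqrt (sigma2 f n)"

definition classF :: "(real \<Rightarrow> real) set" where
  "classF = {f. L1 f \<and> (\<forall>x\<in>Lam. 0 \<le> f x) \<and> G f = 0 \<and>
               (\<lambda>n. sigma f (Suc n) / sigma f n) \<longlonglongrightarrow> 1}"

definition classM :: "(real \<Rightarrow> real) \<Rightarrow> (real \<Rightarrow> real) set" where
  "classM f = {g. (\<forall>x\<in>Lam. 0 \<le> g x) \<and> G g > 0 \<and> L1 (\<lambda>x. f x * g x) \<and>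
                 (\<lambda>n. sigma2 (\<lambda>x. f x * g x) n / sigma2 f n) \<longlonglongrightarrow> G g}"

text \<open>Riemann integrability on [a,b] (Riemann sums over tagged divisions of small mesh,
  i.e. fine with respect to a constant gauge).\<close>
definition riemann_integrable :: "(real \<Rightarrow> real) \<Rightarrow> real \<Rightarrow> real \<Rightarrow> bool" where
  "riemann_integrable f a b \<longleftrightarrow>
     (\<exists>I. \<forall>e>0. \<exists>d>0. \<forall>D. D tagged_division_of {a..b} \<and> (\<lambda>x. ball x d) fine D \<longrightarrow>
        \<bar>(\<Sum>(x,K)\<in>D. Henstock_Kurzweil_Integration.content K * f x) - I\<bar> < e)"

definition classB :: "(real \<Rightarrow> real) set" where
  "classB = {h. (\<forall>x\<in>Lam. 0 \<le> h x) \<and> riemann_integrable h (-pi) pi}"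

definition classBpm :: "(real \<Rightarrow> real) set" where
  "classBpm = {h. h \<in> classB \<and> (\<exists>m M. 0 < m \<and> m \<le> M \<and> (\<forall>x\<in>Lam. m \<le> h x \<and> h x \<le> M))}"

end

theory Submission
  imports Defs "HOL-Real_Asymp.Real_Asymp"
begin

text \<open>
  Write \<open>z = cis (- x)\<close> and let \<open>P\<close> be a complex polynomial of degree \<open>d\<close>. If \<open>|P(z)|\<^sup>2 \<le> g\<close> almost
  everywhere, then multiplying a competitor of degree \<open>n\<close> by \<open>P / P(0)\<close> gives
  \<open>|P(0)|\<^sup>2 \<sigma>\<^sup>2(f, n + d) \<le> \<sigma>\<^sup>2(f g, n)\<close>. If instead \<open>|P(z)|\<^sup>2 \<le> 1 / g\<close>, the same argument gives
  \<open>|P(0)|\<^sup>2 \<sigma>\<^sup>2(f g, n + d) \<le> \<sigma>\<^sup>2(f, n)\<close>. As the ratios \<open>\<sigma>(f, n + 1) / \<sigma>(f, n)\<close> tend to 1, the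
  limit \<open>G(g)\<close> follows as soon as \<open>|P(0)|\<^sup>2\<close> can be brought arbitrarily close to \<open>G(g)\<close> and to
  \<open>1 / G(g)\<close>, respectively. This only uses \<open>f g \<in> L\<^sup>1\<close>, even where \<open>g\<close> has poles.

  The weights that admit such polynomials are closed under products. They contain the exponentials
  of continuous functions on the circle: by Stone--Weierstrass the exponent is nearly \<open>Re Q(z)\<close>, and
  \<open>P = (1 + Q / (2 n)) ^ n\<close> works. Inf-convolution gives continuous minorants of Riemann integrable
  functions and of functions that are bounded below and continuous off a finite set. A zero of
  \<open>q\<close> at \<open>a\<close> is absorbed by a power of \<open>z - cis (- a)\<close>, whose logarithmic mean is 0.
\<close>

section \<open>Prediction errors and polynomial multipliers\<close>

lemma exp_eq_cis_power: "exp (- \<i> * of_nat k * of_real l) = cis (- l) ^ k"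
  unfolding cis_conv_exp exp_of_nat_mult[symmetric]
  by (simp add: algebra_simps)

lemma poly_eq_sum_upto:
  fixes P :: "'a::comm_semiring_1 poly"
  assumes "degree P \<le> n"
  shows "poly P z = (\<Sum>k\<le>n. coeff P k * z ^ k)"
  unfolding poly_altdef
  by (rule sum.mono_neutral_left) (use assms in \<open>auto simp: coeff_eq_0\<close>)

text \<open>With \<open>z = cis (- l)\<close> the competitors are the polynomials of degree at most
  \<open>n\<close> with constant term 1. In this form a competitor can be multiplied by another
  polynomial and renormalized at 0.\<close>

lemma sigma2_poly:
  "sigma2 f n = Inf ((\<lambda>P. integral Lam (\<lambda>l. (cmod (poly P (cis (-l))))\<^sup>2 * f l))
                      ` {P. degree P \<le> n \<and> poly P 0 = 1})"
proof -
  have 1: "\<exists>P. degree P \<le> n \<and> poly P 0 = 1 \<and> (\<forall>z. 1 - (\<Sum>k=1..n. c k * z ^ k) = poly P z)"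
    for c :: "nat \<Rightarrow> complex"
  proof (intro exI conjI allI)
    let ?P = "1 - (\<Sum>k=1..n. monom (c k) k)"
    show "degree ?P \<le> n"
      by (intro degree_diff_le degree_sum_le) (auto intro: order_trans[OF degree_monom_le])
    show "poly ?P 0 = 1"
      by (simp add: poly_sum poly_monom power_0_left sum.neutral)
    show "1 - (\<Sum>k=1..n. c k * z ^ k) = poly ?P z" for z
      by (simp add: poly_sum poly_monom)
  qed
  have 2: "poly P z = 1 - (\<Sum>k=1..n. (- coeff P k) * z ^ k)"
    if "degree P \<le> n" "poly P 0 = 1" for P :: "complex poly" and z
  proof -
    have "poly P z = (\<Sum>k\<in>insert 0 {1..n}. coeff P k * z ^ k)"
      unfolding poly_eq_sum_upto[OF that(1)] by (rule sum.cong) auto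
    then show ?thesis using that(2) by (simp add: sum_negf poly_0_coeff_0)
  qed
  show ?thesis
    unfolding sigma2_def exp_eq_cis_power
  proof (rule arg_cong[where f = Inf], intro equalityI subsetI)
    fix y assume "y \<in> {integral Lam (\<lambda>l. (cmod (1 - (\<Sum>k=1..n. c k * cis (- l) ^ k)))\<^sup>2 * f l) |c. True}"
    then obtain c where c: "y = integral Lam (\<lambda>l. (cmod (1 - (\<Sum>k=1..n. c k * cis (- l) ^ k)))\<^sup>2 * f l)"
      by auto
    obtain P where P: "degree P \<le> n" "poly P 0 = 1"
      "\<And>z. 1 - (\<Sum>k=1..n. c k * z ^ k) = poly P z" using 1[of c] by auto
    show "y \<in> (\<lambda>P. integral Lam (\<lambda>l. (cmod (poly P (cis (-l))))\<^sup>2 * f l))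
                      ` {P. degree P \<le> n \<and> poly P 0 = 1}"
      unfolding c P(3) using P by auto
  next
    fix y assume "y \<in> (\<lambda>P. integral Lam (\<lambda>l. (cmod (poly P (cis (-l))))\<^sup>2 * f l))
                      ` {P. degree P \<le> n \<and> poly P 0 = 1}"
    then obtain P where P: "degree P \<le> n" "poly P 0 = 1"
      and y: "y = integral Lam (\<lambda>l. (cmod (poly P (cis (-l))))\<^sup>2 * f l)" by auto
    show "y \<in> {integral Lam (\<lambda>l. (cmod (1 - (\<Sum>k=1..n. c k * cis (- l) ^ k)))\<^sup>2 * f l) |c. True}"
      unfolding y 2[OF P] by (intro CollectI exI[of _ "\<lambda>k. - coeff P k"]) auto
  qed
qed

lemma Lam_lebesgue [simp]: "Lam \<in> sets lebesgue"
  by (simp add: Lam_def)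

lemma compact_Lam [simp]: "compact Lam"
  by (simp add: Lam_def)

lemma continuous_imp_measurable_on_Lam:
  "continuous_on Lam f \<Longrightarrow> f \<in> borel_measurable (lebesgue_on Lam)"
  by (rule continuous_imp_measurable_on_sets_lebesgue) auto

lemma continuous_imp_absolutely_integrable_on_Lam:
  fixes f :: "real \<Rightarrow> real"
  shows "continuous_on Lam f \<Longrightarrow> f absolutely_integrable_on Lam"
  unfolding Lam_def by (metis absolutely_integrable_continuous_real)

lemma absolutely_integrable_mult_continuous:
  fixes f u :: "real \<Rightarrow> real"
  assumes "continuous_on Lam u" "f absolutely_integrable_on Lam"
  shows "(\<lambda>x. u x * f x) absolutely_integrable_on Lam"
  using assms
  by (intro absolutely_integrable_bounded_measurable_product_real)
     (auto intro!: continuous_imp_measurable_on_Lam compact_imp_bounded compact_continuous_image)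

lemma integrable_poly_weight:
  assumes "f absolutely_integrable_on Lam"
  shows "(\<lambda>l. (cmod (poly P (cis (-l))))\<^sup>2 * f l) integrable_on Lam"
  by (rule set_lebesgue_integral_eq_integral(1)[OF absolutely_integrable_mult_continuous])
     (intro continuous_intros assms)+

lemma bdd_below_poly_weight:
  assumes "f absolutely_integrable_on Lam" "\<forall>x\<in>Lam. 0 \<le> f x"
  shows "bdd_below ((\<lambda>P. integral Lam (\<lambda>l. (cmod (poly P (cis (-l))))\<^sup>2 * f l)) ` S)"
  using assms by (intro bdd_belowI2[where m = 0]) (auto intro!: integral_nonneg integrable_poly_weight)

lemma integral_le_except_negligible:
  fixes f g :: "'a::euclidean_space \<Rightarrow> real"
  assumes "f integrable_on S" "g integrable_on S" "negligible N"
    and le: "\<And>x. x \<in> S - N \<Longrightarrow> f x \<le> g x"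
  shows "integral S f \<le> integral S g"
proof -
  let ?f = "\<lambda>x. if x \<in> N then g x else f x"
  have "integral S f = integral S ?f"
    by (rule integral_spike[OF assms(3)]) auto
  also have "\<dots> \<le> integral S g"
    by (rule integral_le[OF integrable_spike[OF assms(1,3)] assms(2)]) (use le in auto)
  finally show ?thesis .
qed

lemma sigma2_nonneg:
  assumes "f absolutely_integrable_on Lam" "\<forall>x\<in>Lam. 0 \<le> f x"
  shows "0 \<le> sigma2 f n"
  unfolding sigma2_poly
proof (rule cINF_greatest)
  show "{P. degree P \<le> n \<and> poly P 0 = 1} \<noteq> ({} :: complex poly set)"
    using degree_1 poly_1 by (metis (mono_tags, lifting) empty_iff le0 mem_Collect_eq)
qed (use assms in \<open>auto intro!: integral_nonneg integrable_poly_weight\<close>)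

text \<open>If \<open>R\<close> competes for \<open>f2\<close>, then \<open>R * P\<close> divided by
  \<open>P(0)\<close> competes for \<open>f1\<close> in degree \<open>n + d\<close>. The weights
  stay abstract because the bound is read once with \<open>f\<close>, \<open>f g\<close> and once
  with the two exchanged.\<close>

lemma sigma2_mult_poly_le:
  assumes f1: "f1 absolutely_integrable_on Lam" "\<forall>x\<in>Lam. 0 \<le> f1 x"
    and f2: "f2 absolutely_integrable_on Lam" "\<forall>x\<in>Lam. 0 \<le> f2 x"
    and N: "negligible N" "\<And>x. x \<in> Lam - N \<Longrightarrow> (cmod (poly P (cis (-x))))\<^sup>2 * f1 x \<le> f2 x"
    and d: "degree P \<le> d"
  shows "(cmod (poly P 0))\<^sup>2 * sigma2 f1 (n + d) \<le> sigma2 f2 n"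
proof (cases "poly P 0 = 0")
  case True
  then show ?thesis using sigma2_nonneg[OF f2] by simp
next
  case False
  let ?a = "(cmod (poly P 0))\<^sup>2"
  have a: "?a > 0" using False by simp
  show ?thesis
    unfolding sigma2_poly[of f2]
  proof (rule cINF_greatest)
    show "{P. degree P \<le> n \<and> poly P 0 = 1} \<noteq> ({} :: complex poly set)"
      using degree_1 poly_1 by (metis (mono_tags, lifting) empty_iff le0 mem_Collect_eq)
    fix R :: "complex poly"
    assume "R \<in> {P. degree P \<le> n \<and> poly P 0 = 1}"
    then have R: "degree R \<le> n" "poly R 0 = 1" by auto
    define S where "S = smult (1 / poly P 0) (R * P)"
    have S: "degree S \<le> n + d" "poly S 0 = 1"
      using R d False order_trans[OF degree_mult_le[of R P]] by (auto simp: S_def add_mono)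
    have "sigma2 f1 (n + d) \<le> integral Lam (\<lambda>l. (cmod (poly S (cis (-l))))\<^sup>2 * f1 l)"
      unfolding sigma2_poly using S by (intro cINF_lower bdd_below_poly_weight f1) auto
    then have "?a * sigma2 f1 (n + d) \<le> ?a * integral Lam (\<lambda>l. (cmod (poly S (cis (-l))))\<^sup>2 * f1 l)"
      by (intro mult_left_mono) auto
    also have "\<dots> = integral Lam (\<lambda>l. ?a * ((cmod (poly S (cis (-l))))\<^sup>2 * f1 l))"
      by simp
    also have "\<dots> = integral Lam (\<lambda>l. (cmod (poly (R * P) (cis (-l))))\<^sup>2 * f1 l)"
      using False by (simp add: S_def norm_mult norm_divide power_mult_distrib power_divide field_simps)
    also have "\<dots> \<le> integral Lam (\<lambda>l. (cmod (poly R (cis (-l))))\<^sup>2 * f2 l)"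
    proof (rule integral_le_except_negligible[OF _ _ N(1)])
      fix x assume "x \<in> Lam - N"
      then show "(cmod (poly (R * P) (cis (-x))))\<^sup>2 * f1 x \<le> (cmod (poly R (cis (-x))))\<^sup>2 * f2 x"
        using mult_left_mono[OF N(2), of x "(cmod (poly R (cis (-x))))\<^sup>2"]
        by (simp add: norm_mult power_mult_distrib mult.assoc)
    qed (intro integrable_poly_weight f1 f2)+
    finally show "?a * sigma2 f1 (n + d) \<le> integral Lam (\<lambda>l. (cmod (poly R (cis (-l))))\<^sup>2 * f2 l)" .
  qed
qed

lemma sigma2_antimono:
  assumes "f absolutely_integrable_on Lam" "\<forall>x\<in>Lam. 0 \<le> f x"
  shows "sigma2 f (n + d) \<le> sigma2 f n"
  using sigma2_mult_poly_le[OF assms assms negligible_empty, of 1 d n] by simp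

section \<open>Limits of ratios under index shifts\<close>

lemma tendsto_shift_ratio:
  fixes a :: "nat \<Rightarrow> real"
  assumes "(\<lambda>n. a (Suc n) / a n) \<longlonglongrightarrow> 1"
  shows "(\<lambda>n. a (n + d) / a n) \<longlonglongrightarrow> 1"
proof (induction d)
  case 0
  \<comment> \<open>Since \<open>x / 0 = 0\<close>, a positive ratio forces \<open>a n\<close> to be
    nonzero, and only then is \<open>a n / a n\<close> equal to 1.\<close>
  have "eventually (\<lambda>n. a (Suc n) / a n > 0) sequentially"
    using order_tendstoD(1)[OF assms, of 0] by simp
  then have "eventually (\<lambda>n. 1 = a (n + 0) / a n) sequentially"
    by eventually_elim auto
  then show ?case
    by (rule Lim_transform_eventually[OF tendsto_const])
next
  case (Suc d)
  have ev: "eventually (\<lambda>n. a (Suc n) / a n > 0) sequentially"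
    using order_tendstoD(1)[OF assms, of 0] by simp
  have "(\<lambda>n. a (Suc (n + d)) / a (n + d) * (a (n + d) / a n)) \<longlonglongrightarrow> 1 * 1"
    using LIMSEQ_ignore_initial_segment[OF assms, of d] by (intro tendsto_mult Suc.IH)
  moreover have "eventually (\<lambda>n. a (Suc (n + d)) / a (n + d) * (a (n + d) / a n) = a (n + Suc d) / a n) sequentially"
    using sequentially_offset[OF ev, of d] by eventually_elim auto
  ultimately show ?case
    using Lim_transform_eventually by fastforce
qed

text \<open>Divide by \<open>a n\<close> and use that shifted ratios of \<open>a\<close> tend to 1:
  \<open>lo\<close> bounds the lower limit of \<open>b n / a n\<close> from below by
  \<open>p\<close>, which is at least \<open>L * exp (- e)\<close>. In the same way
  \<open>up\<close> bounds the upper limit by \<open>1 / p\<close>, at most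
  \<open>L * exp e\<close>, first at the index \<open>n + d\<close> and then, eventually, at every
  index.\<close>

lemma tendsto_ratio_squeeze:
  fixes a b :: "nat \<Rightarrow> real"
  assumes a: "(\<lambda>n. a (Suc n) / a n) \<longlonglongrightarrow> 1" "\<And>n. 0 < a n"
    and L: "0 < L"
    and lo: "\<And>e. 0 < e \<Longrightarrow> \<exists>p d. L * exp (- e) \<le> p \<and> (\<forall>n. p * a (n + d) \<le> b n)"
    and up: "\<And>e. 0 < e \<Longrightarrow> \<exists>p d. exp (- e) / L \<le> p \<and> (\<forall>n. p * b (n + d) \<le> a n)"
  shows "(\<lambda>n. b n / a n) \<longlonglongrightarrow> L"
proof (rule order_tendstoI)
  fix y assume "y < L"
  moreover have "((\<lambda>e. L * exp (- e)) \<longlongrightarrow> L * exp (- 0)) (at_right 0)"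
    by (intro tendsto_intros)
  ultimately have "eventually (\<lambda>e. y < L * exp (- e)) (at_right 0)"
    using order_tendstoD(1) by force
  from eventually_happens'[OF _ eventually_conj[OF this eventually_at_right_less]]
  obtain e where e: "0 < e" "y < L * exp (- e)" by auto
  from lo[OF e(1)] obtain p d where p: "L * exp (- e) \<le> p" "\<And>n. p * a (n + d) \<le> b n" by auto
  have "(\<lambda>n. p * (a (n + d) / a n)) \<longlonglongrightarrow> p * 1"
    by (intro tendsto_mult tendsto_const tendsto_shift_ratio a(1))
  then have "eventually (\<lambda>n. y < p * (a (n + d) / a n)) sequentially"
    by (rule order_tendstoD) (use e p in auto)
  then show "eventually (\<lambda>n. y < b n / a n) sequentially"
  proof eventually_elim
    case (elim n)
    also have "p * (a (n + d) / a n) \<le> b n / a n"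
      using p(2)[of n] a(2)[of n] by (simp add: divide_right_mono)
    finally show ?case .
  qed
next
  fix y assume "L < y"
  moreover have "((\<lambda>e. L * exp e) \<longlongrightarrow> L * exp 0) (at_right 0)"
    by (intro tendsto_intros)
  ultimately have "eventually (\<lambda>e. L * exp e < y) (at_right 0)"
    using order_tendstoD(2) by force
  from eventually_happens'[OF _ eventually_conj[OF this eventually_at_right_less]]
  obtain e where e: "0 < e" "L * exp e < y" by auto
  from up[OF e(1)] obtain p d where p: "exp (- e) / L \<le> p" "\<And>n. p * b (n + d) \<le> a n" by auto
  have p0: "0 < p" using p(1) L by (meson divide_pos_pos exp_gt_zero less_le_trans)
  have "1 / p \<le> 1 / (exp (- e) / L)"
    using p L p0 by (intro divide_left_mono mult_pos_pos) auto
  also have "\<dots> = L * exp e" by (simp add: exp_minus field_simps)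
  finally have p1: "1 / p < y" using e by simp
  have "(\<lambda>n. 1 / p * (1 / (a (n + d) / a n))) \<longlonglongrightarrow> 1 / p * (1 / 1)"
    by (intro tendsto_mult tendsto_const tendsto_divide tendsto_shift_ratio a(1)) auto
  then have "eventually (\<lambda>n. 1 / p * (1 / (a (n + d) / a n)) < y) sequentially"
    by (rule order_tendstoD) (use p1 in auto)
  then have "eventually (\<lambda>n. b (n + d) / a (n + d) < y) sequentially"
  proof eventually_elim
    case (elim n)
    have "b (n + d) \<le> a n / p"
      using p(2)[of n] p0 by (simp add: field_simps)
    then have "b (n + d) / a (n + d) \<le> (a n / p) / a (n + d)"
      using a(2)[of "n + d"] by (intro divide_right_mono) auto
    also have "\<dots> = 1 / p * (1 / (a (n + d) / a n))" by simp
    finally show ?case using elim by simp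
  qed
  then show "eventually (\<lambda>n. b n / a n < y) sequentially"
    using eventually_sequentially_seg[of "\<lambda>n. b n / a n < y" d] by blast
qed

section \<open>Weights with extremal polynomial minorants\<close>

text \<open>Here \<open>exp u\<close> is the weight, and the exponential of the mean of
  \<open>u\<close> is its geometric mean. By Jensen's inequality \<open>|P(0)|^2\<close> cannot
  exceed this mean when \<open>|P|^2\<close> lies below the weight, so the condition asks for nearly
  extremal \<open>P\<close>. Passing to logarithms turns products of weights into sums.\<close>

definition log_minorized :: "(real \<Rightarrow> real) \<Rightarrow> bool" where
  "log_minorized u \<longleftrightarrow> u absolutely_integrable_on Lam \<and>
     (\<forall>e>0. \<exists>P N. negligible N \<and>
        (\<forall>x\<in>Lam - N. (cmod (poly P (cis (- x))))\<^sup>2 \<le> exp (u x)) \<and>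
        exp (1 / (2 * pi) * integral Lam u - e) \<le> (cmod (poly P 0))\<^sup>2)"

lemma log_minorized_integrable:
  "log_minorized u \<Longrightarrow> u absolutely_integrable_on Lam" "log_minorized u \<Longrightarrow> u integrable_on Lam"
  by (auto simp: log_minorized_def absolutely_integrable_on_def)

lemma log_minorizedE:
  assumes "log_minorized u" "0 < e"
  obtains P N where "negligible N"
    "\<And>x. x \<in> Lam - N \<Longrightarrow> (cmod (poly P (cis (- x))))\<^sup>2 \<le> exp (u x)"
    "exp (1 / (2 * pi) * integral Lam u - e) \<le> (cmod (poly P 0))\<^sup>2"
  using assms unfolding log_minorized_def by metis

lemma log_minorized_spike:
  assumes "log_minorized u" "negligible N" "\<And>x. x \<in> Lam - N \<Longrightarrow> v x = u x"
  shows "log_minorized v"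
  unfolding log_minorized_def
proof (intro conjI allI impI)
  show "v absolutely_integrable_on Lam"
    using absolutely_integrable_spike log_minorized_integrable(1) assms by blast
  have eq: "integral Lam v = integral Lam u"
    by (rule integral_spike[OF assms(2)]) (use assms(3) in auto)
  fix e :: real assume "0 < e"
  then obtain P M where P: "negligible M"
    "\<And>x. x \<in> Lam - M \<Longrightarrow> (cmod (poly P (cis (- x))))\<^sup>2 \<le> exp (u x)"
    "exp (1 / (2 * pi) * integral Lam u - e) \<le> (cmod (poly P 0))\<^sup>2"
    using log_minorizedE[OF assms(1)] by metis
  show "\<exists>P N. negligible N \<and>
        (\<forall>x\<in>Lam - N. (cmod (poly P (cis (- x))))\<^sup>2 \<le> exp (v x)) \<and>
        exp (1 / (2 * pi) * integral Lam v - e) \<le> (cmod (poly P 0))\<^sup>2"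
    using P assms by (intro exI[of _ P] exI[of _ "M \<union> N"]) (auto simp: eq)
qed

text \<open>Polynomial minorants multiply, and so do their values at 0; each factor receives half of
  the error.\<close>

lemma log_minorized_add:
  assumes u: "log_minorized u" and v: "log_minorized v"
  shows "log_minorized (\<lambda>x. u x + v x)"
  unfolding log_minorized_def
proof (intro conjI allI impI)
  show "(\<lambda>x. u x + v x) absolutely_integrable_on Lam"
    by (intro set_integral_add log_minorized_integrable u v)
  have eq: "integral Lam (\<lambda>x. u x + v x) = integral Lam u + integral Lam v"
    by (intro integral_add log_minorized_integrable u v)
  fix e :: real assume e: "0 < e"
  obtain P N where P: "negligible N"
    "\<And>x. x \<in> Lam - N \<Longrightarrow> (cmod (poly P (cis (- x))))\<^sup>2 \<le> exp (u x)"
    "exp (1 / (2 * pi) * integral Lam u - e / 2) \<le> (cmod (poly P 0))\<^sup>2"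
    using log_minorizedE[OF u half_gt_zero[OF e]] by metis
  obtain Q M where Q: "negligible M"
    "\<And>x. x \<in> Lam - M \<Longrightarrow> (cmod (poly Q (cis (- x))))\<^sup>2 \<le> exp (v x)"
    "exp (1 / (2 * pi) * integral Lam v - e / 2) \<le> (cmod (poly Q 0))\<^sup>2"
    using log_minorizedE[OF v half_gt_zero[OF e]] by metis
  show "\<exists>P N. negligible N \<and>
        (\<forall>x\<in>Lam - N. (cmod (poly P (cis (- x))))\<^sup>2 \<le> exp (u x + v x)) \<and>
        exp (1 / (2 * pi) * integral Lam (\<lambda>x. u x + v x) - e) \<le> (cmod (poly P 0))\<^sup>2"
  proof (intro exI conjI ballI)
    show "negligible (N \<union> M)" using P Q by auto
    show "(cmod (poly (P * Q) (cis (- x))))\<^sup>2 \<le> exp (u x + v x)" if "x \<in> Lam - (N \<union> M)" for x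
      unfolding poly_mult norm_mult power_mult_distrib exp_add
      by (intro mult_mono P Q) (use that in auto)
    have "exp (1 / (2 * pi) * integral Lam (\<lambda>x. u x + v x) - e) =
      exp (1 / (2 * pi) * integral Lam u - e / 2) * exp (1 / (2 * pi) * integral Lam v - e / 2)"
      unfolding eq exp_add[symmetric] by (simp add: field_simps)
    also have "\<dots> \<le> (cmod (poly P 0))\<^sup>2 * (cmod (poly Q 0))\<^sup>2"
      by (intro mult_mono P Q) auto
    finally show "exp (1 / (2 * pi) * integral Lam (\<lambda>x. u x + v x) - e) \<le> (cmod (poly (P * Q) 0))\<^sup>2"
      by (simp add: norm_mult power_mult_distrib)
  qed
qed

lemma log_minorized_approx:
  assumes u: "u absolutely_integrable_on Lam"
    and v: "\<And>e. 0 < e \<Longrightarrow> \<exists>v. log_minorized v \<and> (\<forall>x\<in>Lam. v x \<le> u x) \<and> integral Lam u - e \<le> integral Lam v"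
  shows "log_minorized u"
  unfolding log_minorized_def
proof (intro conjI allI impI u)
  fix e :: real assume e: "0 < e"
  \<comment> \<open>After division by \<open>2 * pi\<close> the loss \<open>pi * e\<close> in the
    integral costs \<open>e / 2\<close> in the mean. The other half is left for the polynomial
    minorant of \<open>exp v\<close>.\<close>
  obtain v where v: "log_minorized v" "\<And>x. x \<in> Lam \<Longrightarrow> v x \<le> u x" "integral Lam u - pi * e \<le> integral Lam v"
    using v[of "pi * e"] e by auto
  obtain P N where P: "negligible N"
    "\<And>x. x \<in> Lam - N \<Longrightarrow> (cmod (poly P (cis (- x))))\<^sup>2 \<le> exp (v x)"
    "exp (1 / (2 * pi) * integral Lam v - e / 2) \<le> (cmod (poly P 0))\<^sup>2"
    using log_minorizedE[OF v(1) half_gt_zero[OF e]] by metis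
  have "1 / (2 * pi) * (integral Lam u - pi * e) \<le> 1 / (2 * pi) * integral Lam v"
    by (intro mult_left_mono v) auto
  then have "1 / (2 * pi) * integral Lam u - e \<le> 1 / (2 * pi) * integral Lam v - e / 2"
    by (simp add: field_simps)
  then have "exp (1 / (2 * pi) * integral Lam u - e) \<le> (cmod (poly P 0))\<^sup>2"
    using P(3) by (meson exp_le_cancel_iff order_trans)
  then show "\<exists>P N. negligible N \<and>
        (\<forall>x\<in>Lam - N. (cmod (poly P (cis (- x))))\<^sup>2 \<le> exp (u x)) \<and>
        exp (1 / (2 * pi) * integral Lam u - e) \<le> (cmod (poly P 0))\<^sup>2"
    using P(1,2) v(2)
    by (intro exI[of _ P] exI[of _ N]) (auto intro: order_trans)
qed

section \<open>Exponentials of continuous functions on the circle\<close>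

lemma has_integral_cis_power:
  assumes "0 < k"
  shows "((\<lambda>x. cis (- x) ^ k) has_integral 0) Lam"
proof -
  define F :: "complex \<Rightarrow> complex" where "F z = \<i> / of_nat k * exp (- \<i> * of_nat k * z)" for z
  have F: "F (of_real x) = \<i> / of_nat k * cis (- x) ^ k" for x
    unfolding F_def exp_eq_cis_power ..
  have "((\<lambda>x. cis (- x) ^ k) has_integral F (of_real pi) - F (of_real (- pi))) {- pi..pi}"
  proof (rule fundamental_theorem_of_calculus)
    fix x :: real
    have "(F has_field_derivative exp (- \<i> * of_nat k * of_real x)) (at (of_real x))"
      unfolding F_def using assms by (auto intro!: derivative_eq_intros)
    then show "((\<lambda>x. F (of_real x)) has_vector_derivative cis (- x) ^ k) (at x within {- pi..pi})"
      unfolding exp_eq_cis_power by (rule has_vector_derivative_real_field)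
  qed auto
  moreover have "cis (- pi) = - 1" "cis (- (- pi)) = - 1"
    by (auto simp: complex_eq_iff)
  ultimately show ?thesis
    by (simp add: F Lam_def del: of_real_minus)
qed

text \<open>This is the mean value property: all powers of \<open>cis (- x)\<close> except the
  constant one integrate to 0.\<close>

lemma has_integral_poly_cis:
  "((\<lambda>x. poly Q (cis (- x))) has_integral of_real (2 * pi) * poly Q 0) Lam"
proof -
  have "((\<lambda>x. \<Sum>k\<le>degree Q. coeff Q k * cis (- x) ^ k) has_integral
      (\<Sum>k\<le>degree Q. if k = 0 then of_real (2 * pi) * coeff Q 0 else 0)) Lam"
  proof (intro has_integral_sum)
    fix k
    show "((\<lambda>x. coeff Q k * cis (- x) ^ k) has_integral
        (if k = 0 then of_real (2 * pi) * coeff Q 0 else 0)) Lam"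
    proof (cases "k = 0")
      case True
      then show ?thesis
        using has_integral_const_real[of "coeff Q 0" "- pi" pi]
        by (simp add: Lam_def scaleR_conv_of_real)
    next
      case False
      then show ?thesis
        using has_integral_mult_right[OF has_integral_cis_power, of k "coeff Q k"] by simp
    qed
  qed auto
  then show ?thesis
    by (simp add: poly_altdef poly_0_coeff_0 sum.delta)
qed

lemma has_integral_Re_poly_cis:
  "((\<lambda>x. Re (poly Q (cis (- x)))) has_integral 2 * pi * Re (poly Q 0)) Lam"
  using has_integral_linear[OF has_integral_poly_cis bounded_linear_Re, of Q] by (simp add: o_def)

text \<open>On the circle \<open>cnj z\<close> is the inverse of \<open>z\<close>, so the product is
  a trigonometric polynomial. Its negative frequencies become positive ones under conjugation, which
  preserves the real part. The induction removes the constant coefficients of \<open>A\<close> and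
  \<open>B\<close> together, using \<open>z * cnj z = 1\<close>.\<close>

lemma Re_mult_cnj_poly_on_circle:
  fixes A B :: "complex poly"
  shows "\<exists>Q. \<forall>z\<in>sphere 0 1. Re (poly A z * cnj (poly B z)) = Re (poly Q z)"
proof (induction B arbitrary: A)
  case 0
  show ?case by (intro exI[of _ 0]) auto
next
  case (pCons b B)
  obtain a A' where A: "A = pCons a A'" by (rule pCons_cases)
  from pCons.IH[of A'] obtain Q
    where Q: "\<And>z. z \<in> sphere 0 1 \<Longrightarrow> Re (poly A' z * cnj (poly B z)) = Re (poly Q z)" by auto
  show ?case
  proof (intro exI ballI)
    fix z :: complex assume z: "z \<in> sphere 0 1"
    then have 1: "z * cnj z = 1" by (simp add: complex_norm_square[symmetric] flip: of_real_power)
    have "poly A z * cnj (poly (pCons b B) z)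
        = cnj b * poly A z + a * cnj (z * poly B z) + (z * cnj z) * (poly A' z * cnj (poly B z))"
      by (simp add: A algebra_simps)
    moreover have "Re (a * cnj (z * poly B z)) = Re (cnj a * (z * poly B z))"
      by (simp add: algebra_simps)
    ultimately show "Re (poly A z * cnj (poly (pCons b B) z))
      = Re (poly (smult (cnj b) A + smult (cnj a) (pCons 0 B) + Q) z)"
      unfolding 1 using Q[OF z] by (simp add: algebra_simps)
  qed
qed

text \<open>It converts the approximants of the Stone--Weierstrass theorem into real parts of
  analytic polynomials. Products are handled by
  \<open>Re a * Re b = (Re (a * b) + Re (a * cnj b)) / 2\<close>.\<close>

lemma real_polynomial_function_on_circle:
  fixes g :: "complex \<Rightarrow> real"
  assumes "real_polynomial_function g"
  shows "\<exists>Q. \<forall>z\<in>sphere 0 1. g z = Re (poly Q z)"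
  using assms
proof induction
  case (linear f)
  interpret bounded_linear f by fact
  \<comment> \<open>The coefficient is \<open>f 1 - \<i> * f \<i>\<close>, since the real part of
    its product with \<open>z\<close> is \<open>f 1 * Re z + f \<i> * Im z\<close>.\<close>
  have "f z = Re (poly [:0, Complex (f 1) (- f \<i>):] z)" for z
  proof -
    have "f z = f (Re z *\<^sub>R 1 + Im z *\<^sub>R \<i>)"
      by (rule arg_cong[where f = f]) (simp add: complex_eq_iff)
    also have "\<dots> = Re z * f 1 + Im z * f \<i>"
      unfolding add scaleR by simp
    finally show ?thesis by (simp add: algebra_simps)
  qed
  then show ?case by blast
next
  case (const c)
  show ?case by (intro exI[of _ "[:of_real c:]"]) auto
next
  case (add f g)
  then obtain A B where "\<forall>z\<in>sphere 0 1. f z = Re (poly A z)" "\<forall>z\<in>sphere 0 1. g z = Re (poly B z)"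
    by auto
  then show ?case by (intro exI[of _ "A + B"]) auto
next
  case (mult f g)
  then obtain A B where AB: "\<forall>z\<in>sphere 0 1. f z = Re (poly A z)" "\<forall>z\<in>sphere 0 1. g z = Re (poly B z)"
    by auto
  obtain Q where Q: "\<And>z. z \<in> sphere 0 1 \<Longrightarrow> Re (poly A z * cnj (poly B z)) = Re (poly Q z)"
    using Re_mult_cnj_poly_on_circle by blast
  show ?case
  proof (intro exI ballI)
    fix z :: complex assume z: "z \<in> sphere 0 1"
    have "f z * g z = (Re (poly A z * poly B z) + Re (poly A z * cnj (poly B z))) / 2"
      using AB z by (simp add: field_simps)
    then show "f z * g z = Re (poly (smult (1/2) (A * B + Q)) z)"
      using Q[OF z] by simp
  qed
qed

text \<open>From \<open>1 + t <= exp t\<close>, applied to the squared modulus of one factor. Thus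
  \<open>exp w\<close> can be replaced by a polynomial in \<open>w\<close> whose modulus overshoots
  by a factor that tends to 1.\<close>

lemma norm_one_plus_power_le:
  fixes w :: complex
  assumes "0 < n"
  shows "(cmod ((1 + w / of_nat n) ^ n))\<^sup>2 \<le> exp (2 * Re w + (cmod w)\<^sup>2 / real n)"
proof -
  have "(cmod (1 + w / of_nat n))\<^sup>2 = 1 + (2 * Re w / n + (cmod w)\<^sup>2 / n\<^sup>2)"
    using assms unfolding cmod_power2 by (simp add: field_simps power2_eq_square)
  also have "\<dots> \<le> exp (2 * Re w / n + (cmod w)\<^sup>2 / n\<^sup>2)"
    by (rule exp_ge_add_one_self)
  finally have "((cmod (1 + w / of_nat n))\<^sup>2) ^ n \<le> exp (2 * Re w / n + (cmod w)\<^sup>2 / n\<^sup>2) ^ n"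
    by (intro power_mono) auto
  also have "\<dots> = exp (2 * Re w + (cmod w)\<^sup>2 / real n)"
    unfolding exp_of_nat_mult[symmetric] using assms by (simp add: field_simps power2_eq_square)
  finally show ?thesis
    by (simp add: norm_power power_mult[symmetric] mult.commute)
qed

lemma log_minorized_continuous:
  fixes V :: "complex \<Rightarrow> real"
  assumes V: "continuous_on (sphere 0 1) V"
  shows "log_minorized (\<lambda>x. V (cis (- x)))"
  unfolding log_minorized_def
proof (intro conjI allI impI)
  have cv: "continuous_on Lam (\<lambda>x. V (cis (- x)))"
    by (rule continuous_on_compose2[OF V]) (auto intro!: continuous_intros)
  then show "(\<lambda>x. V (cis (- x))) absolutely_integrable_on Lam"
    by (rule continuous_imp_absolutely_integrable_on_Lam)
  then have intv: "(\<lambda>x. V (cis (- x))) integrable_on Lam"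
    by (simp add: absolutely_integrable_on_def)
  fix e :: real assume e: "0 < e"
  \<comment> \<open>The error is spent in four portions \<open>d\<close>: two for comparing the mean
    of \<open>V\<close> with \<open>Re Q(0)\<close>, one for the limit of powers at 0, and one for
    the factor \<open>exp (- d)\<close> in \<open>|P|^2\<close>.\<close>
  define d where "d = e / 4"
  have d: "0 < d" using e by (simp add: d_def)
  obtain g where g: "real_polynomial_function g" "\<And>z. z \<in> sphere 0 1 \<Longrightarrow> \<bar>V z - g z\<bar> < d"
    using Stone_Weierstrass_real_polynomial_function[OF compact_sphere V d] by blast
  obtain Q0 where Q0: "\<And>z. z \<in> sphere 0 1 \<Longrightarrow> g z = Re (poly Q0 z)"
    using real_polynomial_function_on_circle[OF g(1)] by auto
  \<comment> \<open>Lowering the approximant by \<open>d\<close> turns a two-sided approximation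
    into a minorant of \<open>V\<close>.\<close>
  define Q where "Q = Q0 - [:of_real d:]"
  have Q: "Re (poly Q z) \<le> V z" "V z \<le> Re (poly Q z) + 2 * d" if "z \<in> sphere 0 1" for z
    using g(2)[OF that] Q0[OF that] by (auto simp: Q_def)
  have "integral Lam (\<lambda>x. V (cis (- x))) \<le> integral Lam (\<lambda>x. Re (poly Q (cis (- x))) + 2 * d)"
    by (intro integral_le intv integrable_add Q)
       (use has_integral_integrable[OF has_integral_Re_poly_cis] in \<open>auto simp: Lam_def\<close>)
  also have "\<dots> = 2 * pi * Re (poly Q 0) + 4 * pi * d"
    using has_integral_add[OF has_integral_Re_poly_cis[of Q] has_integral_const_real[of "2 * d" "- pi" pi, folded Lam_def]]
    by (simp add: integral_unique) (simp add: Lam_def)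
  finally have mean: "1 / (2 * pi) * integral Lam (\<lambda>x. V (cis (- x))) \<le> Re (poly Q 0) + 2 * d"
    by (simp add: pos_divide_le_eq algebra_simps)
  have "compact (poly Q ` sphere 0 1)"
    by (intro compact_continuous_image continuous_intros compact_sphere)
  then obtain R where R: "\<And>z. z \<in> sphere 0 1 \<Longrightarrow> cmod (poly Q z) \<le> R"
    by (meson bounded_iff compact_imp_bounded imageI)
  define x where "x = Re (poly Q 0) / 2"
  have "(\<lambda>n. ((1 + x / real n) ^ n)\<^sup>2) \<longlonglongrightarrow> (exp x)\<^sup>2"
    by (intro tendsto_intros tendsto_exp_limit_sequentially)
  also have "(exp x)\<^sup>2 = exp (Re (poly Q 0))"
    by (simp add: x_def exp_double[symmetric])
  finally have "eventually (\<lambda>n. exp (Re (poly Q 0) - d) < ((1 + x / real n) ^ n)\<^sup>2) sequentially"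
    by (rule order_tendstoD) (use d in auto)
  moreover have "eventually (\<lambda>n. R\<^sup>2 / 4 / real n < d) sequentially"
    using order_tendstoD(2)[OF lim_const_over_n[of "R\<^sup>2 / 4"] d] by simp
  ultimately have "eventually (\<lambda>n. exp (Re (poly Q 0) - d) < ((1 + x / real n) ^ n)\<^sup>2 \<and> R\<^sup>2 / 4 / real n < d \<and> 0 < n) sequentially"
    using eventually_gt_at_top[of "0::nat"] by eventually_elim auto
  then obtain n where n: "exp (Re (poly Q 0) - d) < ((1 + x / real n) ^ n)\<^sup>2" "R\<^sup>2 / 4 / real n < d" "0 < n"
    using eventually_happens'[OF sequentially_bot] by blast
  \<comment> \<open>Squaring turns the scalar into \<open>exp (- d)\<close>, which absorbs the
    overshoot \<open>|Q|^2 / (4 n)\<close>; by the choice of \<open>n\<close> this is below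
    \<open>d\<close> on the circle.\<close>
  define P where "P = smult (of_real (exp (- d / 2))) ((1 + smult (1 / of_nat n) (smult (1/2) Q)) ^ n)"
  have P: "poly P z = of_real (exp (- d / 2)) * (1 + (poly Q z / 2) / of_nat n) ^ n" for z
    by (simp add: P_def mult.commute)
  have P2: "(cmod (poly P z))\<^sup>2 = exp (- d) * (cmod ((1 + (poly Q z / 2) / of_nat n) ^ n))\<^sup>2" for z
  proof -
    have "(cmod (of_real (exp (- d / 2))))\<^sup>2 = exp (- d)"
      by (simp add: exp_double[symmetric])
    then show ?thesis
      unfolding P norm_mult power_mult_distrib by (rule arg_cong)
  qed
  show "\<exists>P N. negligible N \<and>
        (\<forall>x\<in>Lam - N. (cmod (poly P (cis (- x))))\<^sup>2 \<le> exp (V (cis (- x)))) \<and>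
        exp (1 / (2 * pi) * integral Lam (\<lambda>x. V (cis (- x))) - e) \<le> (cmod (poly P 0))\<^sup>2"
  proof (intro exI conjI ballI)
    show "negligible ({} :: real set)" by simp
    fix t assume "t \<in> Lam - {}"
    let ?z = "cis (- t)"
    have z: "?z \<in> sphere 0 1" by simp
    have "(cmod (poly P ?z))\<^sup>2 \<le> exp (- d) * exp (2 * Re (poly Q ?z / 2) + (cmod (poly Q ?z / 2))\<^sup>2 / real n)"
      unfolding P2 by (intro mult_left_mono norm_one_plus_power_le n) auto
    also have "\<dots> = exp (Re (poly Q ?z) + ((cmod (poly Q ?z))\<^sup>2 / 4 / real n - d))"
      unfolding exp_add[symmetric] by (simp add: norm_divide power_divide)
    also have "\<dots> \<le> exp (V ?z)"
    proof -
      have "(cmod (poly Q ?z))\<^sup>2 / 4 / real n \<le> R\<^sup>2 / 4 / real n"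
        using R[OF z] by (intro divide_right_mono power_mono) auto
      then show ?thesis using Q(1)[OF z] n(2) by simp
    qed
    finally show "(cmod (poly P ?z))\<^sup>2 \<le> exp (V ?z)" .
  next
    have "exp (1 / (2 * pi) * integral Lam (\<lambda>x. V (cis (- x))) - e) \<le> exp (- d + (Re (poly Q 0) - d))"
      using mean by (simp add: d_def)
    also have "\<dots> \<le> exp (- d) * ((1 + x / real n) ^ n)\<^sup>2"
      unfolding exp_add using n(1) by (intro mult_left_mono) auto
    also have "\<dots> \<le> exp (- d) * (cmod ((1 + (poly Q 0 / 2) / of_nat n) ^ n))\<^sup>2"
    proof -
      \<comment> \<open>At 0 only a lower bound is required, so the imaginary part of
        \<open>Q(0)\<close> may be dropped.\<close>
      have "\<bar>1 + x / real n\<bar> \<le> cmod (1 + (poly Q 0 / 2) / of_nat n)"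
        using abs_Re_le_cmod[of "1 + (poly Q 0 / 2) / of_nat n"] by (simp add: x_def Re_divide_of_nat)
      then have "\<bar>1 + x / real n\<bar> ^ n \<le> cmod (1 + (poly Q 0 / 2) / of_nat n) ^ n"
        by (intro power_mono) auto
      then have "\<bar>(1 + x / real n) ^ n\<bar> \<le> \<bar>cmod ((1 + (poly Q 0 / 2) / of_nat n) ^ n)\<bar>"
        by (simp add: norm_power power_abs)
      then show ?thesis
        by (intro mult_left_mono) (simp_all only: abs_le_square_iff exp_ge_zero)
    qed
    finally show "exp (1 / (2 * pi) * integral Lam (\<lambda>x. V (cis (- x))) - e) \<le> (cmod (poly P 0))\<^sup>2"
      unfolding P2 .
  qed
qed

section \<open>Continuous minorants by inf-convolution\<close>

text \<open>Measuring distances on the circle instead of \<open>Lam\<close> makes the minorants periodic.\<close>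

definition infconv :: "(real \<Rightarrow> real) \<Rightarrow> nat \<Rightarrow> complex \<Rightarrow> real" where
  "infconv u n z = (INF y\<in>Lam. u y + real n * cmod (z - cis (- y)))"

text \<open>For \<open>u\<close> bounded below, \<open>infconv u n\<close> is
  \<open>n\<close>-Lipschitz and increases with \<open>n\<close>. At interior points of
  \<open>Lam\<close> the supremum is the lower semicontinuous envelope of \<open>u\<close>; at the
  endpoints, which are one point of the circle, it takes both sides into account.\<close>

definition lower_envelope :: "(real \<Rightarrow> real) \<Rightarrow> real \<Rightarrow> real" where
  "lower_envelope u x = (SUP n. infconv u n (cis (- x)))"

lemma Lam_nonempty: "Lam \<noteq> {}"
  using pi_ge_zero by (auto simp: Lam_def)

lemma cis_uminus_eq_imp_eq:
  assumes "cis (- x) = cis (- y)" "\<bar>x - y\<bar> < 2 * pi"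
  shows "x = y"
proof -
  have "cis (x - y) = 1"
    using cis_mult[of x "- y"] cis_mult[of x "- x"] assms(1) by simp
  then have "cos (x - y) = 1" by (metis cis.sel(1) one_complex.sel(1))
  then obtain k :: int where k: "x - y = of_int k * 2 * pi"
    using cos_one_2pi_int by blast
  then have "\<bar>of_int k\<bar> * (2 * pi) < 1 * (2 * pi)"
    using assms(2) by (simp add: abs_mult mult.assoc)
  then have "\<bar>real_of_int k\<bar> < 1"
    by (rule mult_right_less_imp_less) simp
  then have "k = 0" by linarith
  then show ?thesis using k by simp
qed

text \<open>Balls of constant radius form a gauge, so \<open>I\<close> is also the
  Henstock--Kurzweil integral. The mesh condition is handed on as well, because it survives a change
  of tags.\<close>

lemma riemann_integrableE:
  assumes "riemann_integrable f a b"
  obtains I where "(f has_integral I) {a..b}"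
    "\<And>e. 0 < e \<Longrightarrow> \<exists>d>0. \<forall>D. D tagged_division_of {a..b} \<and> (\<lambda>x. ball x d) fine D \<longrightarrow>
        \<bar>(\<Sum>(x,K)\<in>D. Henstock_Kurzweil_Integration.content K * f x) - I\<bar> < e"
proof -
  obtain I where I: "\<And>e. 0 < e \<Longrightarrow> \<exists>d>0. \<forall>D. D tagged_division_of {a..b} \<and> (\<lambda>x. ball x d) fine D \<longrightarrow>
        \<bar>(\<Sum>(x,K)\<in>D. Henstock_Kurzweil_Integration.content K * f x) - I\<bar> < e"
    using assms unfolding riemann_integrable_def by auto
  have "(f has_integral I) {a..b}"
    unfolding has_integral_real
  proof (intro allI impI)
    fix e :: real assume "0 < e"
    from I[OF this] obtain d where "0 < d" "\<forall>D. D tagged_division_of {a..b} \<and> (\<lambda>x. ball x d) fine D \<longrightarrow>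
        \<bar>(\<Sum>(x,K)\<in>D. Henstock_Kurzweil_Integration.content K * f x) - I\<bar> < e" by auto
    then show "\<exists>\<gamma>. gauge \<gamma> \<and> (\<forall>D. D tagged_division_of {a..b} \<and> \<gamma> fine D \<longrightarrow>
       norm ((\<Sum>(x,K)\<in>D. Henstock_Kurzweil_Integration.content K *\<^sub>R f x) - I) < e)"
      by (intro exI[of _ "\<lambda>x. ball x d"]) (auto intro: gauge_ball)
  qed
  then show thesis using I by (rule that)
qed

lemma riemann_integrable_uminus:
  assumes "riemann_integrable f a b"
  shows "riemann_integrable (\<lambda>x. - f x) a b"
proof -
  obtain I where I: "\<And>e. 0 < e \<Longrightarrow> \<exists>d>0. \<forall>D. D tagged_division_of {a..b} \<and> (\<lambda>x. ball x d) fine D \<longrightarrow>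
        \<bar>(\<Sum>(x,K)\<in>D. Henstock_Kurzweil_Integration.content K * f x) - I\<bar> < e"
    using riemann_integrableE[OF assms] by metis
  have eq: "\<bar>(\<Sum>(x,K)\<in>D. Henstock_Kurzweil_Integration.content K * (- f x)) - (- I)\<bar>
      = \<bar>(\<Sum>(x,K)\<in>D. Henstock_Kurzweil_Integration.content K * f x) - I\<bar>" for D
    by (simp add: case_prod_unfold sum_negf abs_minus_commute)
  show ?thesis
    unfolding riemann_integrable_def by (rule exI[of _ "- I"], unfold eq) (use I in blast)
qed

lemma absolutely_integrable_bounded_below:
  fixes f :: "real \<Rightarrow> real"
  assumes "f integrable_on Lam" "\<And>x. x \<in> Lam \<Longrightarrow> c \<le> f x"
  shows "f absolutely_integrable_on Lam"
proof -
  have c: "(\<lambda>x. c) absolutely_integrable_on Lam"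
    by (intro continuous_imp_absolutely_integrable_on_Lam continuous_intros)
  then have "(\<lambda>x. f x - c) integrable_on Lam"
    by (intro integrable_diff assms) (simp add: absolutely_integrable_on_def)
  then have "(\<lambda>x. f x - c) absolutely_integrable_on Lam"
    by (rule nonnegative_absolutely_integrable_1) (use assms in auto)
  from set_integral_add(1)[OF this c] show ?thesis by simp
qed

context
  fixes u :: "real \<Rightarrow> real" and c :: real
  assumes lower: "\<And>x. x \<in> Lam \<Longrightarrow> c \<le> u x"
begin

lemma infconv_bdd_below: "bdd_below ((\<lambda>y. u y + real n * cmod (z - cis (- y))) ` Lam)"
  using lower by (intro bdd_belowI2[where m = c]) (simp add: add_increasing2)

lemma infconv_ge: "c \<le> infconv u n z"
  unfolding infconv_def using lower Lam_nonempty
  by (intro cINF_greatest) (auto simp: add_increasing2)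

lemma infconv_le: "x \<in> Lam \<Longrightarrow> infconv u n (cis (- x)) \<le> u x"
  unfolding infconv_def using cINF_lower[OF infconv_bdd_below, of x n "cis (- x)"] by simp

lemma infconv_triangle: "infconv u n z \<le> infconv u n w + real n * cmod (z - w)"
proof -
  have "infconv u n z - real n * cmod (z - w) \<le> infconv u n w"
    unfolding infconv_def[of _ _ w]
  proof (rule cINF_greatest[OF Lam_nonempty])
    fix y assume y: "y \<in> Lam"
    have "infconv u n z \<le> u y + real n * cmod (z - cis (- y))"
      unfolding infconv_def by (rule cINF_lower[OF infconv_bdd_below y])
    also have "\<dots> \<le> u y + real n * (cmod (z - w) + cmod (w - cis (- y)))"
      by (intro add_left_mono mult_left_mono)
         (use norm_triangle_ineq[of "z - w" "w - cis (- y)"] in auto)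
    finally show "infconv u n z - real n * cmod (z - w) \<le> u y + real n * cmod (w - cis (- y))"
      by (simp add: algebra_simps)
  qed
  then show ?thesis by simp
qed

lemma continuous_on_infconv: "continuous_on S (infconv u n)"
proof -
  have "(real n)-lipschitz_on S (infconv u n)"
  proof (rule lipschitz_onI)
    fix z w
    show "dist (infconv u n z) (infconv u n w) \<le> real n * dist z w"
      using infconv_triangle[of n z w] infconv_triangle[of n w z]
      by (simp add: dist_norm norm_minus_commute abs_le_iff)
  qed auto
  then show ?thesis by (rule lipschitz_on_continuous_on)
qed

lemma incseq_infconv: "incseq (\<lambda>n. infconv u n z)"
  unfolding infconv_def
proof (intro incseq_SucI cINF_mono Lam_nonempty infconv_bdd_below)
  fix n y assume "y \<in> Lam"
  then show "\<exists>x\<in>Lam. u x + real n * cmod (z - cis (- x)) \<le> u y + real (Suc n) * cmod (z - cis (- y))"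
    by (intro bexI[of _ y] add_left_mono mult_right_mono) auto
qed

lemma bdd_above_infconv: "x \<in> Lam \<Longrightarrow> bdd_above (range (\<lambda>n. infconv u n (cis (- x))))"
  using infconv_le by (intro bdd_aboveI2) auto

lemma infconv_tendsto: "x \<in> Lam \<Longrightarrow> (\<lambda>n. infconv u n (cis (- x))) \<longlonglongrightarrow> lower_envelope u x"
  unfolding lower_envelope_def by (intro LIMSEQ_incseq_SUP incseq_infconv bdd_above_infconv)

text \<open>Points of \<open>Lam\<close> at distance at least \<open>d\<close> from the interior
  point \<open>x\<close> have, by compactness, a chordal distance of at least some
  \<open>\<eta> > 0\<close>. For large \<open>n\<close> the penalty \<open>n * \<eta>\<close>
  outweighs \<open>m - c\<close>, so the infimum is governed by the points within
  \<open>d\<close>.\<close>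

lemma lower_envelope_ge_local:
  assumes x: "-pi < x" "x < pi" and d: "0 < d"
    and m: "\<And>y. y \<in> Lam \<Longrightarrow> \<bar>y - x\<bar> < d \<Longrightarrow> m \<le> u y"
  shows "m \<le> lower_envelope u x"
proof -
  define K where "K = Lam - ball x d"
  have K: "compact K" by (simp add: K_def compact_diff)
  obtain \<eta> where \<eta>: "0 < \<eta>" "\<And>y. y \<in> K \<Longrightarrow> \<eta> \<le> cmod (cis (- x) - cis (- y))"
  proof (cases "K = {}")
    case True
    then show ?thesis using that[of 1] by auto
  next
    case False
    have "continuous_on K (\<lambda>y. cmod (cis (- x) - cis (- y)))"
      by (intro continuous_intros)
    then obtain y0 where y0: "y0 \<in> K" "\<And>y. y \<in> K \<Longrightarrow> cmod (cis (- x) - cis (- y0)) \<le> cmod (cis (- x) - cis (- y))"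
      using continuous_attains_inf[OF K False] by blast
    have "\<bar>x - y0\<bar> < 2 * pi" "x \<noteq> y0"
      using x y0(1) d by (auto simp: K_def Lam_def abs_less_iff)
    then have "cis (- x) \<noteq> cis (- y0)"
      using cis_uminus_eq_imp_eq[of x y0] by auto
    then show ?thesis using y0(2) by (intro that[of "cmod (cis (- x) - cis (- y0))"]) auto
  qed
  obtain n :: nat where n: "m - c \<le> real n * \<eta>"
    using reals_Archimedean3[OF \<eta>(1)] less_imp_le by blast
  have "m \<le> infconv u n (cis (- x))"
    unfolding infconv_def
  proof (rule cINF_greatest[OF Lam_nonempty])
    fix y assume y: "y \<in> Lam"
    show "m \<le> u y + real n * cmod (cis (- x) - cis (- y))"
    proof (cases "\<bar>y - x\<bar> < d")
      case True
      then show ?thesis using m[OF y] by (simp add: add_increasing2)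
    next
      case False
      then have "y \<in> K" using y by (auto simp: K_def dist_real_def)
      from mult_left_mono[OF \<eta>(2)[OF this], of "real n"] lower[OF y] n
      show ?thesis by simp
    qed
  qed
  also have "\<dots> \<le> lower_envelope u x"
    unfolding lower_envelope_def
    by (rule cSUP_upper[OF _ bdd_above_infconv]) (use x in \<open>auto simp: Lam_def\<close>)
  finally show ?thesis .
qed

lemma lower_envelope_integral:
  assumes u: "u absolutely_integrable_on Lam"
  shows "lower_envelope u integrable_on Lam"
    and "(\<lambda>n. integral Lam (\<lambda>x. infconv u n (cis (- x)))) \<longlonglongrightarrow> integral Lam (lower_envelope u)"
proof -
  have 1: "(\<lambda>x. infconv u n (cis (- x))) integrable_on Lam" for n
    unfolding Lam_def
    by (intro integrable_continuous_real continuous_on_compose2[OF continuous_on_infconv[of UNIV n]])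
       (auto intro!: continuous_intros)
  have 2: "(\<lambda>x. \<bar>c\<bar> + \<bar>u x\<bar>) integrable_on Lam"
    using u by (intro integrable_add) (auto simp: absolutely_integrable_on_def Lam_def)
  have 3: "norm (infconv u n (cis (- x))) \<le> \<bar>c\<bar> + \<bar>u x\<bar>" if "x \<in> Lam" for n x
    using infconv_le[OF that, of n] infconv_ge[of n "cis (- x)"] by auto
  show "lower_envelope u integrable_on Lam"
       "(\<lambda>n. integral Lam (\<lambda>x. infconv u n (cis (- x)))) \<longlonglongrightarrow> integral Lam (lower_envelope u)"
    using dominated_convergence[OF 1 2 3 infconv_tendsto] by blast+
qed

text \<open>The hypothesis \<open>env\<close> says that passing to the envelope loses no mass, so
  dominated convergence makes some \<open>infconv u n\<close> good enough. The bound
  \<open>c <= V\<close> is recorded because it keeps \<open>V\<close> positive when a logarithm is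
  taken later.\<close>

lemma continuous_minorant_exists:
  assumes u: "u absolutely_integrable_on Lam"
    and env: "integral Lam u \<le> integral Lam (lower_envelope u)" and e: "0 < e"
  obtains V where "continuous_on UNIV V" "\<And>x. x \<in> Lam \<Longrightarrow> V (cis (- x)) \<le> u x" "\<And>z. c \<le> V z"
    "integral Lam u - e \<le> integral Lam (\<lambda>x. V (cis (- x)))"
proof -
  have "integral Lam u - e < integral Lam (lower_envelope u)" using env e by simp
  from eventually_happens'[OF sequentially_bot order_tendstoD(1)[OF lower_envelope_integral(2)[OF u] this]]
  obtain n where "integral Lam u - e < integral Lam (\<lambda>x. infconv u n (cis (- x)))" by blast
  then show ?thesis
    by (intro that[of "infconv u n"] continuous_on_infconv infconv_le infconv_ge) auto
qed

text \<open>At an interior point of continuity the envelope is at least \<open>u\<close>; the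
  remaining points form a finite set. Neither periodicity nor an upper bound is asked of
  \<open>u\<close>.\<close>

lemma log_minorized_continuous_off_finite:
  assumes u: "u absolutely_integrable_on Lam" and S: "finite S"
    and cont: "\<And>x. x \<in> Lam - S \<Longrightarrow> continuous (at x) u"
  shows "log_minorized u"
proof (rule log_minorized_approx[OF u])
  have "integral Lam u \<le> integral Lam (lower_envelope u)"
  proof (rule integral_le_except_negligible)
    show "u integrable_on Lam" using u by (simp add: absolutely_integrable_on_def)
    show "lower_envelope u integrable_on Lam" by (rule lower_envelope_integral[OF u])
    show "negligible (S \<union> {-pi, pi})" using S by (intro negligible_finite) auto
    fix x assume x: "x \<in> Lam - (S \<union> {-pi, pi})"
    show "u x \<le> lower_envelope u x"
    proof (rule field_le_epsilon)
      fix e :: real assume e: "0 < e"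
      have "continuous (at x) u" using x cont by auto
      then obtain d where d: "0 < d" "\<And>y. \<bar>y - x\<bar> < d \<Longrightarrow> \<bar>u y - u x\<bar> < e"
        using e unfolding continuous_at_eps_delta by (auto simp: dist_real_def)
      have "u x - e \<le> lower_envelope u x"
        using x d by (intro lower_envelope_ge_local[OF _ _ d(1)]) (force simp: Lam_def)+
      then show "u x \<le> lower_envelope u x + e" by simp
    qed
  qed
  note env = this
  fix e :: real assume "0 < e"
  from continuous_minorant_exists[OF u env this] obtain V where V: "continuous_on UNIV V"
    "\<And>x. x \<in> Lam \<Longrightarrow> V (cis (- x)) \<le> u x"
    "integral Lam u - e \<le> integral Lam (\<lambda>x. V (cis (- x)))" by metis
  then show "\<exists>v. log_minorized v \<and> (\<forall>x\<in>Lam. v x \<le> u x) \<and> integral Lam u - e \<le> integral Lam v"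
    by (intro exI[of _ "\<lambda>x. V (cis (- x))"] conjI log_minorized_continuous)
       (auto intro: continuous_on_subset)
qed

text \<open>This is Darboux's argument. Retagging a fine division by points where \<open>u\<close>
  nearly attains its infimum shows that the lower sum is close to the integral, and inside each
  interval the envelope dominates that infimum.\<close>

lemma lower_envelope_integral_ge_riemann:
  assumes u: "u absolutely_integrable_on Lam" and riem: "riemann_integrable u (- pi) pi"
  shows "integral Lam u \<le> integral Lam (lower_envelope u)"
proof -
  obtain I where u_I: "(u has_integral I) {-pi..pi}" and I: "\<And>e. 0 < e \<Longrightarrow> \<exists>d>0. \<forall>D. D tagged_division_of {-pi..pi} \<and> (\<lambda>x. ball x d) fine D \<longrightarrow>
        \<bar>(\<Sum>(x,K)\<in>D. Henstock_Kurzweil_Integration.content K * u x) - I\<bar> < e"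
    using riemann_integrableE[OF riem] by metis
  from u_I have Iu: "integral Lam u = I" by (simp add: Lam_def integral_unique)
  show ?thesis
  proof (rule field_le_epsilon)
    fix e :: real assume e: "0 < e"
    obtain d where d: "0 < d" "\<And>D. D tagged_division_of {-pi..pi} \<Longrightarrow> (\<lambda>x. ball x d) fine D \<Longrightarrow>
        \<bar>(\<Sum>(x,K)\<in>D. Henstock_Kurzweil_Integration.content K * u x) - I\<bar> < e / 2"
      using I[of "e / 2"] e by auto
    \<comment> \<open>With radius \<open>d / 2\<close> every interval stays within distance
      \<open>d\<close> of any of its points, so the retagged division is still fine.\<close>
    obtain D where D: "D tagged_division_of {-pi..pi}" "(\<lambda>x. ball x (d / 2)) fine D"
      using fine_division_exists_real[of "\<lambda>x. ball x (d / 2)"] d(1) gauge_ball[of "d / 2"] by auto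
    define \<K> where "\<K> = snd ` D"
    have K: "\<K> division_of {-pi..pi}"
      unfolding \<K>_def by (rule division_of_tagged_division[OF D(1)])
    note KD = division_ofD[OF K]
    have uK: "bdd_below (u ` K)" if "K \<in> \<K>" for K
      using lower KD(2)[OF that] by (intro bdd_belowI2[where m = c]) (auto simp: Lam_def)
    define m where "m K = (INF x\<in>K. u x)" for K
    \<comment> \<open>Over the total length \<open>2 * pi\<close> the slack adds up to
      \<open>e / 2\<close>.\<close>
    have "\<exists>t\<in>K. u t < m K + e / (4 * pi)" if "K \<in> \<K>" for K
    proof -
      have "(INF x\<in>K. u x) < m K + e / (4 * pi)" using e by (simp add: m_def)
      then show ?thesis using cINF_less_iff[OF KD(3)[OF that] uK[OF that]] by auto
    qed
    then obtain t where t: "\<And>K. K \<in> \<K> \<Longrightarrow> t K \<in> K" "\<And>K. K \<in> \<K> \<Longrightarrow> u (t K) < m K + e / (4 * pi)"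
      by metis
    define D' where "D' = (\<lambda>K. (t K, K)) ` \<K>"
    have D': "D' tagged_division_of {-pi..pi}"
        unfolding D'_def
    proof (rule tagged_division_ofI)
      have "{K. \<exists>x. (x, K) \<in> (\<lambda>K. (t K, K)) ` \<K>} = \<K>" by auto
      then show "\<Union>{K. \<exists>x. (x, K) \<in> (\<lambda>K. (t K, K)) ` \<K>} = {-pi..pi}"
        using KD(6) by simp
      fix x1 K1 x2 K2
      assume "(x1, K1) \<in> (\<lambda>K. (t K, K)) ` \<K>" "(x2, K2) \<in> (\<lambda>K. (t K, K)) ` \<K>" "(x1, K1) \<noteq> (x2, K2)"
      then show "interior K1 \<inter> interior K2 = {}" by (intro KD(5)) auto
    qed (use KD(1,2,4) t(1) in \<open>auto simp del: box_real\<close>)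
    have fine: "(\<lambda>x. ball x d) fine D'"
    proof (rule fineI)
      fix x K assume "(x, K) \<in> D'"
      then have K: "K \<in> \<K>" "x = t K" by (auto simp: D'_def)
      then obtain y where "(y, K) \<in> D" by (auto simp: \<K>_def)
      then have "K \<subseteq> ball y (d / 2)" using D(2) by (auto simp: fine_def)
      then show "K \<subseteq> ball x d"
        using t(1)[OF K(1)] K(2) dist_triangle_half_r[of y x d] by (auto simp: subset_iff)
    qed
    have "I - e / 2 \<le> (\<Sum>(x,K)\<in>D'. Henstock_Kurzweil_Integration.content K * u x)"
      using d(2)[OF D' fine] by linarith
    also have "\<dots> = (\<Sum>K\<in>\<K>. Henstock_Kurzweil_Integration.content K * u (t K))"
      unfolding D'_def by (subst sum.reindex) (auto simp: inj_on_def)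
    also have "\<dots> \<le> (\<Sum>K\<in>\<K>. Henstock_Kurzweil_Integration.content K * (m K + e / (4 * pi)))"
      by (intro sum_mono mult_left_mono t(2)[THEN less_imp_le]) auto
    also have "\<dots> = (\<Sum>K\<in>\<K>. Henstock_Kurzweil_Integration.content K * m K)
        + (\<Sum>K\<in>\<K>. Henstock_Kurzweil_Integration.content K) * (e / (4 * pi))"
      by (simp only: distrib_left sum.distrib sum_distrib_right)
    also have "(\<Sum>K\<in>\<K>. Henstock_Kurzweil_Integration.content K) = 2 * pi"
      using additive_content_division[of \<K> "-pi" pi] K by simp
    also have "(\<Sum>K\<in>\<K>. Henstock_Kurzweil_Integration.content K * m K) \<le> (\<Sum>K\<in>\<K>. integral K (lower_envelope u))"
    proof (rule sum_mono)
      fix K assume KK: "K \<in> \<K>"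
      then obtain a b where ab: "K = {a..b}" using KD(4) by (metis box_real(2))
      have sub: "{a..b} \<subseteq> {-pi..pi}" and ne: "a \<le> b" using KD(2,3)[OF KK] ab by auto
      have mK: "m K \<le> lower_envelope u x" if x: "x \<in> {a..b} - {a, b}" for x
      proof (rule lower_envelope_ge_local)
        have "-pi \<le> a" "b \<le> pi" using sub ne by auto
        then show "-pi < x" "x < pi" using x by auto
        show "0 < min (x - a) (b - x)" using x by auto
        fix y assume "\<bar>y - x\<bar> < min (x - a) (b - x)"
        then have "y \<in> K" unfolding ab by auto
        then show "m K \<le> u y" unfolding m_def by (rule cINF_lower[OF uK[OF KK]])
      qed
      have "Henstock_Kurzweil_Integration.content K * m K = integral K (\<lambda>x. m K)"
        unfolding ab by (simp add: integral_const_real)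
      also have "\<dots> \<le> integral K (lower_envelope u)"
      proof (rule integral_le_except_negligible[of _ _ _ "{a, b}"])
        show "lower_envelope u integrable_on K"
          using integrable_on_subinterval[OF lower_envelope_integral(1)[OF u], of a b] sub
          by (simp add: ab Lam_def)
      qed (use mK ab in auto)
      finally show "Henstock_Kurzweil_Integration.content K * m K \<le> integral K (lower_envelope u)" .
    qed
    also have "(\<Sum>K\<in>\<K>. integral K (lower_envelope u)) = integral Lam (lower_envelope u)"
      using integral_combine_division_topdown[OF lower_envelope_integral(1)[OF u], of \<K>] K by (simp add: Lam_def)
    finally show "integral Lam u \<le> integral Lam (lower_envelope u) + e"
      by (simp add: Iu)
  qed
qed

end

section \<open>Logarithms of Riemann integrable functions bounded away from 0\<close>

lemma absolutely_integrable_classBpm: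
  assumes "h \<in> classBpm"
  shows "h absolutely_integrable_on Lam" "(\<lambda>x. ln (h x)) absolutely_integrable_on Lam"
proof -
  obtain m M where m: "0 < m" "\<And>x. x \<in> Lam \<Longrightarrow> m \<le> h x" "\<And>x. x \<in> Lam \<Longrightarrow> h x \<le> M"
    and r: "riemann_integrable h (- pi) pi"
    using assms by (auto simp: classBpm_def classB_def)
  have "h integrable_on Lam"
    using riemann_integrableE[OF r] unfolding Lam_def by (metis has_integral_integrable)
  then show h: "h absolutely_integrable_on Lam"
    using m(2) by (rule absolutely_integrable_bounded_below)
  show "(\<lambda>x. ln (h x)) absolutely_integrable_on Lam"
  proof (rule measurable_bounded_by_integrable_imp_absolutely_integrable)
    have "h \<in> borel_measurable (lebesgue_on Lam)"
      using h absolutely_integrable_measurable Lam_lebesgue by blast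
    then show "(\<lambda>x. ln (h x)) \<in> borel_measurable (lebesgue_on Lam)" by measurable
    show "(\<lambda>x. \<bar>ln m\<bar> + \<bar>ln M\<bar>) integrable_on Lam"
      unfolding Lam_def by (rule integrable_const_ivl)
    fix x assume x: "x \<in> Lam"
    have "ln m \<le> ln (h x)" "ln (h x) \<le> ln M"
      using m(1) m(2,3)[OF x] by auto
    then show "norm (ln (h x)) \<le> \<bar>ln m\<bar> + \<bar>ln M\<bar>" by auto
  qed auto
qed

text \<open>The minorant is built for \<open>h\<close> and the logarithm is taken afterwards. As
  \<open>m <= V <= h\<close>, one has \<open>ln h - ln V <= (h - V) / m\<close>, so a loss of
  \<open>m * e\<close> in the integral of \<open>h\<close> costs at most \<open>e\<close> in that of
  \<open>ln h\<close>.\<close>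

lemma log_minorized_ln_classBpm:
  assumes "h \<in> classBpm"
  shows "log_minorized (\<lambda>x. ln (h x))"
proof (rule log_minorized_approx)
  note h = absolutely_integrable_classBpm[OF assms]
  then show "(\<lambda>x. ln (h x)) absolutely_integrable_on Lam" by blast
  obtain m where m: "0 < m" "\<And>x. x \<in> Lam \<Longrightarrow> m \<le> h x"
    and r: "riemann_integrable h (- pi) pi"
    using assms by (auto simp: classBpm_def classB_def)
  fix e :: real assume e: "0 < e"
  then have "0 < m * e" using m by simp
  then obtain V where V: "continuous_on UNIV V" "\<And>x. x \<in> Lam \<Longrightarrow> V (cis (- x)) \<le> h x" "\<And>z. m \<le> V z"
    "integral Lam h - m * e \<le> integral Lam (\<lambda>x. V (cis (- x)))"
    using continuous_minorant_exists[OF m(2) h(1) lower_envelope_integral_ge_riemann[OF m(2) h(1) r]] by metis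
  have V0: "0 < V z" for z using m(1) V(3)[of z] by simp
  define v where "v = (\<lambda>x. ln (V (cis (- x))))"
  have lm: "log_minorized v" "log_minorized (\<lambda>x. V (cis (- x)))"
    unfolding v_def using V0
    by (auto intro!: log_minorized_continuous continuous_intros continuous_on_subset[OF V(1)] simp: less_imp_neq[THEN not_sym])
  have int: "(\<lambda>x. ln (h x)) integrable_on Lam" "v integrable_on Lam" "h integrable_on Lam"
    "(\<lambda>x. V (cis (- x))) integrable_on Lam"
    using h log_minorized_integrable(2) lm by (auto simp: absolutely_integrable_on_def)
  have "integral Lam (\<lambda>x. ln (h x) - v x) \<le> integral Lam (\<lambda>x. (h x - V (cis (- x))) / m)"
  proof (rule integral_le)
    fix x assume x: "x \<in> Lam"
    have hx: "0 < h x" using m(1) m(2)[OF x] by simp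
    have "ln (h x) - v x \<le> (h x - V (cis (- x))) / V (cis (- x))"
      unfolding v_def by (rule ln_diff_le[OF hx V0])
    also have "\<dots> \<le> (h x - V (cis (- x))) / m"
      using V(2)[OF x] V(3)[of "cis (- x)"] V0[of "cis (- x)"] m(1) by (intro divide_left_mono) auto
    finally show "ln (h x) - v x \<le> (h x - V (cis (- x))) / m" .
  qed (intro integrable_diff integrable_on_divide int)+
  also have "\<dots> = (integral Lam h - integral Lam (\<lambda>x. V (cis (- x)))) / m"
    by (simp add: integral_diff int)
  also have "\<dots> \<le> e"
    using V(4) m(1) by (simp add: field_simps)
  finally have "integral Lam (\<lambda>x. ln (h x)) - e \<le> integral Lam v"
    by (simp add: integral_diff int)
  moreover have "v x \<le> ln (h x)" if "x \<in> Lam" for x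
    unfolding v_def using V(2)[OF that] V0[of "cis (- x)"] by auto
  ultimately show "\<exists>v. log_minorized v \<and> (\<forall>x\<in>Lam. v x \<le> ln (h x)) \<and> integral Lam (\<lambda>x. ln (h x)) - e \<le> integral Lam v"
    using lm by blast
qed

lemma sphere_eq_cis:
  assumes "z \<in> sphere 0 1"
  shows "\<exists>x\<in>Lam. z = cis (- x)"
proof
  have "z \<noteq> 0" "sgn z = z" using assms by (auto simp: sgn_eq)
  then show "z = cis (- (- Arg z))" using cis_Arg[of z] by simp
  show "- Arg z \<in> Lam" using Arg_bounded[of z] by (simp add: Lam_def)
qed

text \<open>A continuous minorant \<open>V\<close> of \<open>- h\<close> gives the continuous
  majorant \<open>- V\<close> of \<open>h\<close>, and \<open>- ln (- V)\<close> lies below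
  \<open>- ln h\<close>. The difference is at most \<open>(- V - h) / m\<close>.\<close>

lemma log_minorized_uminus_ln_classBpm:
  assumes "h \<in> classBpm"
  shows "log_minorized (\<lambda>x. - ln (h x))"
proof (rule log_minorized_approx)
  note h = absolutely_integrable_classBpm[OF assms]
  show "(\<lambda>x. - ln (h x)) absolutely_integrable_on Lam"
    using absolutely_integrable_scaleR_left[OF h(2), of "- 1"] by simp
  obtain m M where m: "0 < m" "\<And>x. x \<in> Lam \<Longrightarrow> m \<le> h x" "\<And>x. x \<in> Lam \<Longrightarrow> h x \<le> M"
    and r: "riemann_integrable h (- pi) pi"
    using assms by (auto simp: classBpm_def classB_def)
  have M: "x \<in> Lam \<Longrightarrow> - M \<le> - h x" for x using m(3) by simp
  have h': "(\<lambda>x. - h x) absolutely_integrable_on Lam"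
    using absolutely_integrable_scaleR_left[OF h(1), of "- 1"] by simp
  fix e :: real assume e: "0 < e"
  then have "0 < m * e" using m by simp
  then obtain V where V: "continuous_on UNIV V" "\<And>x. x \<in> Lam \<Longrightarrow> V (cis (- x)) \<le> - h x"
    "integral Lam (\<lambda>x. - h x) - m * e \<le> integral Lam (\<lambda>x. V (cis (- x)))"
    using continuous_minorant_exists[OF M h'
        lower_envelope_integral_ge_riemann[OF M h' riemann_integrable_uminus[OF r]]] by metis
  \<comment> \<open>The sign is known on the circle only, where every point is
    \<open>cis (- x)\<close> for some \<open>x\<close> in \<open>Lam\<close>.\<close>
  have V0: "V z < 0" if "z \<in> sphere 0 1" for z
    using sphere_eq_cis[OF that] V(2) m(1,2) by force
  define v where "v = (\<lambda>x. - ln (- V (cis (- x))))"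
  have "continuous_on (sphere 0 1) (\<lambda>z. - ln (- V z))"
    using V0 by (intro continuous_intros continuous_on_subset[OF V(1)]) fastforce+
  then have lm: "log_minorized v" "log_minorized (\<lambda>x. V (cis (- x)))"
    unfolding v_def by (auto intro!: log_minorized_continuous continuous_on_subset[OF V(1)])
  have int: "(\<lambda>x. ln (h x)) integrable_on Lam" "v integrable_on Lam" "h integrable_on Lam"
    "(\<lambda>x. V (cis (- x))) integrable_on Lam"
    using h log_minorized_integrable(2) lm by (auto simp: absolutely_integrable_on_def)
  have "integral Lam (\<lambda>x. - ln (h x) - v x) \<le> integral Lam (\<lambda>x. (- h x - V (cis (- x))) / m)"
  proof (rule integral_le)
    fix x assume x: "x \<in> Lam"
    have hx: "0 < h x" using m(1) m(2)[OF x] by simp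
    have Vx: "0 < - V (cis (- x))" using V0[of "cis (- x)"] by simp
    have "- ln (h x) - v x \<le> (- V (cis (- x)) - h x) / h x"
      unfolding v_def using ln_diff_le[OF Vx hx] by simp
    also have "\<dots> \<le> (- V (cis (- x)) - h x) / m"
      using V(2)[OF x] m(2)[OF x] hx m(1) by (intro divide_left_mono) auto
    also have "\<dots> = (- h x - V (cis (- x))) / m"
      by (rule arg_cong[where f = "\<lambda>y. y / m"]) simp
    finally show "- ln (h x) - v x \<le> (- h x - V (cis (- x))) / m" .
  qed (intro integrable_diff integrable_on_divide integrable_neg int)+
  also have "\<dots> = (integral Lam (\<lambda>x. - h x) - integral Lam (\<lambda>x. V (cis (- x)))) / m"
    by (subst integral_diff[symmetric]) (auto intro!: integrable_neg int)
  also have "\<dots> \<le> e"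
    using V(3) m(1) by (simp add: field_simps)
  also have "integral Lam (\<lambda>x. - ln (h x) - v x) = integral Lam (\<lambda>x. - ln (h x)) - integral Lam v"
    by (intro integral_diff integrable_neg int)
  finally have "integral Lam (\<lambda>x. - ln (h x)) - e \<le> integral Lam v"
    by simp
  moreover have "v x \<le> - ln (h x)" if "x \<in> Lam" for x
    unfolding v_def using V(2)[OF that] m(1) m(2)[OF that] by auto
  ultimately show "\<exists>v. log_minorized v \<and> (\<forall>x\<in>Lam. v x \<le> - ln (h x)) \<and> integral Lam (\<lambda>x. - ln (h x)) - e \<le> integral Lam v"
    using lm by blast
qed

section \<open>Logarithms of polynomials\<close>

lemma isCont_mult_ln_square: "isCont (\<lambda>t::real. t * ln (t\<^sup>2)) x"
proof (cases "x = 0")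
  case True
  have "((\<lambda>t::real. t * ln (t\<^sup>2)) \<longlongrightarrow> 0) (at_left 0)" by real_asymp
  moreover have "((\<lambda>t::real. t * ln (t\<^sup>2)) \<longlongrightarrow> 0) (at_right 0)" by real_asymp
  ultimately show ?thesis
    unfolding True isCont_def by (simp add: filterlim_split_at)
next
  case False
  then show ?thesis by (intro continuous_intros) auto
qed

lemma ln_abs_eq_ln_square: "ln \<bar>t::real\<bar> = ln (t\<^sup>2) / 2"
  using ln_realpow[of "\<bar>t\<bar>" 2] by (cases "t = 0") auto

text \<open>The primitive \<open>F\<close> extends continuously across the singularity, so the
  fundamental theorem applies with the single exceptional point \<open>b\<close>. Integrability is
  absolute because the integrand is bounded above.\<close>

lemma absolutely_integrable_ln_abs: "(\<lambda>x. ln \<bar>x - b\<bar>) absolutely_integrable_on Lam"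
proof -
  define F where "F x = (x - b) * ln ((x - b)\<^sup>2) / 2 - x" for x :: real
  have "((\<lambda>x. ln \<bar>x - b\<bar>) has_integral (F pi - F (- pi))) {- pi..pi}"
  proof (rule fundamental_theorem_of_calculus_strong[of "{b}"])
    fix x assume "x \<in> {- pi..pi} - {b}"
    then have x: "x - b \<noteq> 0" by auto
    then have "0 < (x - b)\<^sup>2" by simp
    then have "(F has_real_derivative
        (1 * ln ((x - b)\<^sup>2) + (x - b) * (1 / (x - b)\<^sup>2 * (2 * (x - b)))) / 2 - 1) (at x)"
      unfolding F_def by (auto intro!: derivative_eq_intros)
    also have "(1 * ln ((x - b)\<^sup>2) + (x - b) * (1 / (x - b)\<^sup>2 * (2 * (x - b)))) / 2 - 1 = ln \<bar>x - b\<bar>"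
    proof -
      have "(1 * ln (t\<^sup>2) + t * (1 / t\<^sup>2 * (2 * t))) / 2 - 1 = ln (t\<^sup>2) / 2" if "t \<noteq> 0" for t :: real
        using that by (simp add: power2_eq_square add_divide_distrib)
      from this[OF x] show ?thesis unfolding ln_abs_eq_ln_square .
    qed
    finally show "(F has_vector_derivative ln \<bar>x - b\<bar>) (at x)"
      by (simp add: has_real_derivative_iff_has_vector_derivative)
  next
    have "isCont (\<lambda>x. (x - b) * ln ((x - b)\<^sup>2)) x" for x
      using isCont_o2[OF _ isCont_mult_ln_square, of x "\<lambda>x. x - b"] by simp
    then show "continuous_on {- pi..pi} F"
      unfolding F_def
      by (intro continuous_on_diff continuous_on_divide continuous_on_const continuous_on_id)
         (auto intro: continuous_at_imp_continuous_on)
  qed auto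
  then have "(\<lambda>x. ln \<bar>x - b\<bar>) integrable_on Lam"
    unfolding Lam_def by (rule has_integral_integrable)
  then have "(\<lambda>x. - ln \<bar>x - b\<bar>) integrable_on Lam"
    by (rule integrable_neg)
  then have "(\<lambda>x. - ln \<bar>x - b\<bar>) absolutely_integrable_on Lam"
  proof (rule absolutely_integrable_bounded_below)
    fix x assume "x \<in> Lam"
    \<comment> \<open>The summand 1 makes the logarithm of the bound nonnegative; this covers
      \<open>x = b\<close>, where \<open>ln 0 = 0\<close>.\<close>
    then have "\<bar>x - b\<bar> \<le> 1 + pi + \<bar>b\<bar>" by (auto simp: Lam_def)
    then have "ln \<bar>x - b\<bar> \<le> ln (1 + pi + \<bar>b\<bar>)"
      by (cases "x = b") (auto intro!: ln_ge_zero)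
    then show "- ln (1 + pi + \<bar>b\<bar>) \<le> - ln \<bar>x - b\<bar>" by simp
  qed
  from absolutely_integrable_scaleR_left[OF this, of "- 1"] show ?thesis by simp
qed

section \<open>Chordal distance and its logarithm\<close>

text \<open>On the first half \<open>s - s^3 / 6 <= sin s\<close>, and the parabola is below the
  cubic as soon as \<open>pi * s <= 6\<close>. The second half follows by the symmetry
  \<open>s\<close> to \<open>pi - s\<close>.\<close>

lemma sin_ge_parabola:
  assumes "0 \<le> s" "s \<le> pi"
  shows "s * (pi - s) / pi \<le> sin s"
proof -
  have *: "s * (pi - s) / pi \<le> sin s" if "0 \<le> s" "s \<le> pi / 2" for s :: real
  proof -
    have "\<bar>sin s - (\<Sum>m<3. sin_coeff m * s ^ m)\<bar> \<le> inverse (fact 3) * \<bar>s\<bar> ^ 3"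
      by (rule Maclaurin_sin_bound)
    moreover have "(\<Sum>m<3. sin_coeff m * s ^ m) = s"
      by (simp add: eval_nat_numeral sin_coeff_def)
    moreover have "inverse (fact 3) * \<bar>s\<bar> ^ 3 = s ^ 3 / 6"
      using that by (simp add: fact_numeral)
    ultimately have "s - s ^ 3 / 6 \<le> sin s" by linarith
    moreover have "s * (pi - s) / pi \<le> s - s ^ 3 / 6"
    proof -
      have "pi * s \<le> 6"
      proof -
        have "pi * s \<le> 3.2 * (3.2 / 2)"
          using that pi_approx by (intro mult_mono) auto
        then show ?thesis by simp
      qed
      then have "s\<^sup>2 * (pi * s) \<le> s\<^sup>2 * 6"
        by (intro mult_left_mono) auto
      then show ?thesis
        by (simp add: field_simps power2_eq_square power3_eq_cube)
    qed
    ultimately show ?thesis by linarith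
  qed
  show ?thesis
  proof (cases "s \<le> pi / 2")
    case True
    then show ?thesis using * assms by simp
  next
    case False
    then show ?thesis using *[of "pi - s"] assms by (simp add: mult.commute)
  qed
qed

lemma norm_cis_diff: "cmod (cis (- x) - cis (- a)) = 2 * \<bar>sin ((x - a) / 2)\<bar>"
proof -
  have "cis (- x) - cis (- a) = cis (- a) * (cis (a - x) - 1)"
    by (simp add: algebra_simps cis_mult)
  then have "cmod (cis (- x) - cis (- a)) = cmod (exp (\<i> * of_real (a - x)) - 1)"
    by (simp add: norm_mult cis_conv_exp)
  also have "\<dots> = 2 * \<bar>sin ((a - x) / 2)\<bar>" by (rule dist_exp_i_1)
  also have "sin ((a - x) / 2) = - sin ((x - a) / 2)"
    by (metis minus_diff_eq minus_divide_left sin_minus)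
  finally show ?thesis by simp
qed

lemma norm_cis_diff_le: "cmod (cis (- x) - cis (- a)) \<le> \<bar>x - a\<bar>"
  unfolding norm_cis_diff using abs_sin_x_le_abs_x[of "(x - a) / 2"] by simp

lemma abs_sin_eq: "\<bar>y\<bar> \<le> pi \<Longrightarrow> \<bar>sin y\<bar> = sin \<bar>y\<bar>"
  using sin_ge_zero[of "\<bar>y\<bar>"] by (cases "0 \<le> y") auto

text \<open>The chord vanishes at distance 0 and again at distance \<open>2 * pi\<close>, which is
  reached between the endpoints of \<open>Lam\<close>; hence the two factors.\<close>

lemma norm_cis_diff_ge:
  assumes "\<bar>x - a\<bar> \<le> 2 * pi"
  shows "\<bar>x - a\<bar> * (2 * pi - \<bar>x - a\<bar>) / (2 * pi) \<le> cmod (cis (- x) - cis (- a))"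
proof -
  have "\<bar>sin ((x - a) / 2)\<bar> = sin (\<bar>x - a\<bar> / 2)"
    using assms abs_sin_eq[of "(x - a) / 2"] by simp
  then show ?thesis
    unfolding norm_cis_diff
    using sin_ge_parabola[of "\<bar>x - a\<bar> / 2"] assms by (simp add: right_diff_distrib diff_divide_distrib)
qed

lemma cis_eq_on_Lam_subset:
  assumes "a \<in> Lam"
  shows "{x \<in> Lam. cis (- x) = cis (- a)} \<subseteq> {a, -pi, pi}"
proof
  fix x assume x: "x \<in> {x \<in> Lam. cis (- x) = cis (- a)}"
  show "x \<in> {a, -pi, pi}"
  proof (cases "\<bar>x - a\<bar> < 2 * pi")
    case True
    then show ?thesis using cis_uminus_eq_imp_eq[of x a] x by auto
  next
    case False
    then show ?thesis using x assms by (auto simp: Lam_def abs_if split: if_splits)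
  qed
qed

lemma absolutely_integrable_ln_norm_cis_diff:
  assumes a: "a \<in> Lam"
  shows "(\<lambda>x. ln (cmod (cis (- x) - cis (- a)))) absolutely_integrable_on Lam"
proof (rule measurable_bounded_by_integrable_imp_absolutely_integrable)
  \<comment> \<open>The constants come from the chord being at most 2, from the denominator of the
    parabola, and from \<open>2 * pi + t <= 4 * pi\<close>. The singular terms belong to
    \<open>a\<close> and its two translates by a period.\<close>
  let ?g = "\<lambda>x. ln 2 + ln (2 * pi) + ln (4 * pi) + \<bar>ln \<bar>x - a\<bar>\<bar> + \<bar>ln \<bar>x - (a + 2 * pi)\<bar>\<bar> + \<bar>ln \<bar>x - (a - 2 * pi)\<bar>\<bar>"
  have "(\<lambda>x. cmod (cis (- x) - cis (- a))) \<in> borel_measurable (lebesgue_on Lam)"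
    by (intro continuous_imp_measurable_on_Lam continuous_intros)
  then show "(\<lambda>x. ln (cmod (cis (- x) - cis (- a)))) \<in> borel_measurable (lebesgue_on Lam)"
    by measurable
  have *: "(\<lambda>x. \<bar>ln \<bar>x - b\<bar>\<bar>) integrable_on Lam" for b
    using absolutely_integrable_ln_abs[of b] by (simp add: absolutely_integrable_on_def)
  have c: "(\<lambda>x. ln 2 + ln (2 * pi) + ln (4 * pi)) integrable_on Lam"
    unfolding Lam_def by (rule integrable_const_ivl)
  show "?g integrable_on Lam"
    by (intro integrable_add c *)
  have pos: "0 \<le> ln (2 * pi)" "0 \<le> ln (4 * pi)"
    using pi_gt3 by (auto intro!: ln_ge_zero)
  fix x assume x: "x \<in> Lam"
  define t where "t = \<bar>x - a\<bar>"
  have t: "0 \<le> t" "t \<le> 2 * pi" using x a by (auto simp: t_def Lam_def)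
  show "norm (ln (cmod (cis (- x) - cis (- a)))) \<le> ?g x"
  proof (cases "cis (- x) = cis (- a)")
    case True
    then show ?thesis using pos by simp
  next
    case False
    let ?n = "cmod (cis (- x) - cis (- a))"
    have n: "0 < ?n" using False by simp
    have "?n \<le> 2" using norm_triangle_ineq4[of "cis (- x)" "cis (- a)"] by simp
    then have up: "ln ?n \<le> ln 2" using n by simp
    have "x \<noteq> a" using False by auto
    show ?thesis
    proof (cases "t = 2 * pi")
      case True
      then have "\<bar>sin ((x - a) / 2)\<bar> = \<bar>sin pi\<bar>"
        using abs_sin_eq[of "(x - a) / 2"] by (simp add: t_def)
      then have "?n = 0" unfolding norm_cis_diff by simp
      then show ?thesis using n by simp
    next
      case ne: False
      have t0: "0 < t" "t < 2 * pi" using t ne \<open>x \<noteq> a\<close> by (auto simp: t_def)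
      have "t * (2 * pi - t) / (2 * pi) \<le> ?n"
        using norm_cis_diff_ge[of x a] t by (simp add: t_def)
      then have "ln (t * (2 * pi - t) / (2 * pi)) \<le> ln ?n"
        using t0 by (intro ln_mono) auto
      also have "ln (t * (2 * pi - t) / (2 * pi)) = ln t + ln (2 * pi - t) - ln (2 * pi)"
        using t0 by (simp add: ln_div ln_mult)
      finally have 1: "ln t + ln (2 * pi - t) - ln (2 * pi) \<le> ln ?n" .
      \<comment> \<open>Which translate realizes \<open>2 * pi - t\<close> depends on the sign of
        \<open>x - a\<close>; the product with \<open>2 * pi + t\<close> is the same in both
        cases.\<close>
      have "ln (2 * pi - t) + ln (2 * pi + t) = ln ((2 * pi - t) * (2 * pi + t))"
        using t0 by (simp add: ln_mult)
      also have "(2 * pi - t) * (2 * pi + t) = \<bar>x - (a + 2 * pi)\<bar> * \<bar>x - (a - 2 * pi)\<bar>"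
      proof -
        have "\<bar>x - (a + 2 * pi)\<bar> = 2 * pi - (x - a)" "\<bar>x - (a - 2 * pi)\<bar> = 2 * pi + (x - a)"
          using t unfolding t_def by auto
        then show ?thesis
          unfolding t_def by (cases "a \<le> x") (simp_all add: algebra_simps)
      qed
      also have "ln \<dots> = ln \<bar>x - (a + 2 * pi)\<bar> + ln \<bar>x - (a - 2 * pi)\<bar>"
        using t0 unfolding t_def by (intro ln_mult_pos) auto
      finally have 2: "ln (2 * pi - t) + ln (2 * pi + t) = ln \<bar>x - (a + 2 * pi)\<bar> + ln \<bar>x - (a - 2 * pi)\<bar>" .
      have 3: "ln (2 * pi + t) \<le> ln (4 * pi)" using t0 by simp
      have 4: "0 \<le> ln (2 :: real)" by simp
      \<comment> \<open>The estimates are combined as pure linear arithmetic, with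
        \<open>A = ln t\<close>, \<open>D = ln (2 * pi - t)\<close>,
        \<open>E = ln (2 * pi + t)\<close> and \<open>n\<close> the logarithm of the chord.\<close>
      have "\<bar>n\<bar> \<le> l + l2 + l4 + \<bar>A\<bar> + \<bar>B\<bar> + \<bar>C\<bar>"
        if "A + D - l2 \<le> n" "D + E = B + C" "E \<le> l4" "0 \<le> l" "n \<le> l" "0 \<le> l2" "0 \<le> l4"
        for A B C D E n l l2 l4 :: real
        using that by linarith
      from this[OF 1 2 3 4 up pos] show ?thesis unfolding t_def real_norm_def .
    qed
  qed
qed auto

section \<open>Jensen's formula for linear factors\<close>

text \<open>The partial sums of the power series of \<open>ln (1 - w)\<close> are polynomials in
  \<open>w\<close> that vanish at 0, so their real parts have mean 0. A geometric series dominates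
  them.\<close>

lemma has_integral_ln_norm_one_minus:
  assumes c: "cmod c < 1"
  shows "((\<lambda>x. ln (cmod (1 - c * cis (- x)))) has_integral 0) Lam"
proof (rule has_integral_dominated_convergence)
  let ?f = "\<lambda>N x. \<Sum>n<N. Re (- ((c * cis (- x)) ^ n) / of_nat n)"
  fix N
  \<comment> \<open>The term for \<open>n = 0\<close> is 0, since division by 0 yields 0, so
    \<open>Q\<close> has no constant term.\<close>
  define Q where "Q = (\<Sum>n<N. monom (- (c ^ n) / of_nat n) n)"
  have "?f N x = Re (poly Q (cis (- x)))" for x
    by (simp add: Q_def poly_sum poly_monom power_mult_distrib)
  moreover have "poly Q 0 = 0"
    unfolding Q_def poly_sum poly_monom by (intro sum.neutral) (auto simp: power_0_left)
  ultimately show "(?f N has_integral 0) Lam"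
    using has_integral_Re_poly_cis[of Q] by simp
  show "\<forall>x\<in>Lam. norm (?f N x) \<le> 1 / (1 - cmod c)"
  proof
    fix x
    have "norm (?f N x) \<le> (\<Sum>n<N. norm (Re (- ((c * cis (- x)) ^ n) / of_nat n)))"
      by (rule norm_sum)
    also have "\<dots> \<le> (\<Sum>n<N. cmod c ^ n)"
    proof (rule sum_mono)
      fix n
      have "norm (Re (- ((c * cis (- x)) ^ n) / of_nat n)) \<le> cmod (- ((c * cis (- x)) ^ n) / of_nat n)"
        unfolding real_norm_def by (rule abs_Re_le_cmod)
      also have "\<dots> = cmod c ^ n / real n"
        by (simp add: norm_divide norm_power norm_mult)
      also have "\<dots> \<le> cmod c ^ n"
        using divide_left_mono[of 1 "real n" "cmod c ^ n"] by (cases "n = 0") auto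
      finally show "norm (Re (- ((c * cis (- x)) ^ n) / of_nat n)) \<le> cmod c ^ n" .
    qed
    also have "\<dots> \<le> (\<Sum>n. cmod c ^ n)"
      using c by (intro sum_le_suminf summable_geometric) auto
    also have "\<dots> = 1 / (1 - cmod c)"
      using c by (intro suminf_geometric) auto
    finally show "norm (?f N x) \<le> 1 / (1 - cmod c)" .
  qed
next
  show "(\<lambda>x. 1 / (1 - cmod c)) integrable_on Lam"
    unfolding Lam_def by (rule integrable_const_ivl)
  show "\<forall>x\<in>Lam. (\<lambda>N. \<Sum>n<N. Re (- ((c * cis (- x)) ^ n) / of_nat n)) \<longlonglongrightarrow> ln (cmod (1 - c * cis (- x)))"
  proof
    fix x
    let ?w = "c * cis (- x)"
    have w: "cmod (- ?w) < 1" using c by (simp add: norm_mult)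
    then have "1 - ?w \<noteq> 0" by auto
    moreover have "(\<lambda>n. Re (- ((- (- ?w)) ^ n) / of_nat n)) sums Re (ln (1 + - ?w))"
      by (intro sums_Re Ln_series' w)
    ultimately show "(\<lambda>N. \<Sum>n<N. Re (- (?w ^ n) / of_nat n)) \<longlonglongrightarrow> ln (cmod (1 - ?w))"
      unfolding sums_def by simp
  qed
  show "(\<lambda>N. 0) \<longlonglongrightarrow> (0::real)" by simp
qed

lemma norm_cis_diff_eq_one_minus: "cmod (cis (- x) - cis (- a)) = cmod (1 - cis a * cis (- x))"
proof -
  have "1 - cis a * cis (- x) = - cis a * (cis (- x) - cis (- a))"
    by (simp add: right_diff_distrib cis_mult)
  then show ?thesis by (simp add: norm_mult)
qed

text \<open>Jensen's formula at a boundary zero: dominated convergence along dilations applies since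
  \<open>|1 - w| \<le> 2 |1 - r w|\<close> for \<open>|w| = 1\<close>, \<open>0 \<le> r \<le> 1\<close>.\<close>

lemma integral_ln_norm_cis_diff:
  assumes a: "a \<in> Lam"
  shows "integral Lam (\<lambda>x. ln (cmod (cis (- x) - cis (- a)))) = 0"
proof -
  define r where "r k = 1 - 1 / real (k + 2)" for k
  have r: "0 \<le> r k" "r k < 1" for k by (auto simp: r_def)
  have rlim: "r \<longlonglongrightarrow> 1" unfolding r_def by real_asymp
  define N where "N = {x \<in> Lam. cis (- x) = cis (- a)}"
  have N: "negligible N"
    using cis_eq_on_Lam_subset[OF a] by (intro negligible_finite) (auto simp: N_def intro: finite_subset)
  \<comment> \<open>On \<open>N\<close> the dilated logarithms diverge to minus infinity, whereas
    \<open>?g\<close> has the value \<open>ln 0 = 0\<close>; setting them to 0 there gives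
    convergence everywhere.\<close>
  let ?f = "\<lambda>k x. if x \<in> N then 0 else ln (cmod (1 - of_real (r k) * cis a * cis (- x)))"
  let ?g = "\<lambda>x. ln (cmod (cis (- x) - cis (- a)))"
  have "(?g has_integral 0) Lam"
  proof (rule has_integral_dominated_convergence)
    show "(?f k has_integral 0) Lam" for k
    proof (rule has_integral_spike[OF N])
      show "((\<lambda>x. ln (cmod (1 - of_real (r k) * cis a * cis (- x)))) has_integral 0) Lam"
        using r[of k] by (intro has_integral_ln_norm_one_minus) (simp add: norm_mult)
    qed auto
    have c: "(\<lambda>x. ln 2 + ln 2 :: real) integrable_on Lam"
      unfolding Lam_def by (rule integrable_const_ivl)
    show "(\<lambda>x. ln 2 + ln 2 + \<bar>?g x\<bar>) integrable_on Lam"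
      using absolutely_integrable_ln_norm_cis_diff[OF a]
      by (intro integrable_add[OF c]) (simp add: absolutely_integrable_on_def)
    show "\<forall>x\<in>Lam. norm (?f k x) \<le> ln 2 + ln 2 + \<bar>?g x\<bar>" for k
    proof
      fix x assume x: "x \<in> Lam"
      show "norm (?f k x) \<le> ln 2 + ln 2 + \<bar>?g x\<bar>"
      proof (cases "x \<in> N")
        case True
        then show ?thesis by simp
      next
        case False
        define w where "w = cis a * cis (- x)"
        have w: "cmod w = 1" by (simp add: w_def norm_mult)
        have g: "?g x = ln (cmod (1 - w))" unfolding w_def norm_cis_diff_eq_one_minus ..
        have n0: "0 < cmod (1 - w)"
          using False x by (simp add: N_def w_def norm_cis_diff_eq_one_minus[symmetric] del: right_minus_eq)
             (metis norm_cis_diff_eq_one_minus norm_eq_zero right_minus_eq)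
        have "cmod (of_real (r k) * w) = r k" using r[of k] w by (simp add: norm_mult)
        then have 1: "1 - r k \<le> cmod (1 - of_real (r k) * w)"
          using norm_triangle_ineq2[of 1 "of_real (r k) * w"] by simp
        have "1 - w = (1 - of_real (r k) * w) - of_real (1 - r k) * w"
          by (simp add: algebra_simps)
        then have "cmod (1 - w) \<le> cmod (1 - of_real (r k) * w) + cmod (of_real (1 - r k) * w)"
          by (metis norm_triangle_ineq4)
        also have "cmod (of_real (1 - r k) * w) = 1 - r k"
          using r[of k] w by (simp add: norm_mult del: of_real_diff)
        finally have 2: "cmod (1 - w) \<le> 2 * cmod (1 - of_real (r k) * w)" using 1 by simp
        have pos: "0 < cmod (1 - of_real (r k) * w)" using 2 n0 by linarith
        have "ln (cmod (1 - w)) \<le> ln (2 * cmod (1 - of_real (r k) * w))"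
          using 2 n0 pos by (subst ln_le_cancel_iff) auto
        also have "\<dots> = ln 2 + ln (cmod (1 - of_real (r k) * w))"
          using pos by (intro ln_mult_pos) auto
        finally have 3: "ln (cmod (1 - w)) \<le> ln 2 + ln (cmod (1 - of_real (r k) * w))" .
        have "cmod (1 - of_real (r k) * w) \<le> 2"
          using norm_triangle_ineq4[of 1 "of_real (r k) * w"] \<open>cmod (of_real (r k) * w) = r k\<close> r[of k] by simp
        then have "ln (cmod (1 - of_real (r k) * w)) \<le> ln 2"
          using pos by simp
        moreover have "0 \<le> ln (2::real)" by simp
        moreover have "?f k x = ln (cmod (1 - of_real (r k) * w))"
          using False by (simp add: w_def mult.assoc)
        ultimately show ?thesis
          unfolding g using 3 by (simp only: real_norm_def abs_le_iff) linarith
      qed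
    qed
    show "\<forall>x\<in>Lam. (\<lambda>k. ?f k x) \<longlonglongrightarrow> ?g x"
    proof
      fix x assume x: "x \<in> Lam"
      show "(\<lambda>k. ?f k x) \<longlonglongrightarrow> ?g x"
      proof (cases "x \<in> N")
        case True
        then show ?thesis by (simp add: N_def)
      next
        case False
        have "cmod (cis (- x) - cis (- a)) \<noteq> 0" using False x by (simp add: N_def)
        then have "cmod (1 - of_real 1 * cis a * cis (- x)) \<noteq> 0"
          unfolding norm_cis_diff_eq_one_minus by simp
        then have "(\<lambda>k. ln (cmod (1 - of_real (r k) * cis a * cis (- x)))) \<longlonglongrightarrow> ln (cmod (1 - of_real 1 * cis a * cis (- x)))"
          by (intro tendsto_intros rlim) auto
        then show ?thesis using False by (simp add: norm_cis_diff_eq_one_minus)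
      qed
    qed
    show "(\<lambda>k. 0) \<longlonglongrightarrow> (0::real)" by simp
  qed
  then show ?thesis by (rule integral_unique)
qed

text \<open>Off a finite set the weight equals \<open>|P|^2\<close> for \<open>P\<close> the
  \<open>k\<close>-th power of \<open>z - cis (- a)\<close>. Here \<open>|P(0)| = 1\<close> matches
  the geometric mean 1 exactly.\<close>

lemma log_minorized_ln_norm_cis_diff:
  assumes a: "a \<in> Lam"
  shows "log_minorized (\<lambda>x. real (2 * k) * ln (cmod (cis (- x) - cis (- a))))"
  unfolding log_minorized_def
proof (intro conjI allI impI)
  show "(\<lambda>x. real (2 * k) * ln (cmod (cis (- x) - cis (- a)))) absolutely_integrable_on Lam"
    using absolutely_integrable_scaleR_left[OF absolutely_integrable_ln_norm_cis_diff[OF a], of "real (2 * k)"] by simp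
  have i: "integral Lam (\<lambda>x. real (2 * k) * ln (cmod (cis (- x) - cis (- a)))) = 0"
    using integral_ln_norm_cis_diff[OF a] by simp
  fix e :: real assume e: "0 < e"
  show "\<exists>P N. negligible N \<and>
        (\<forall>x\<in>Lam - N. (cmod (poly P (cis (- x))))\<^sup>2 \<le> exp (real (2 * k) * ln (cmod (cis (- x) - cis (- a))))) \<and>
        exp (1 / (2 * pi) * integral Lam (\<lambda>x. real (2 * k) * ln (cmod (cis (- x) - cis (- a)))) - e) \<le> (cmod (poly P 0))\<^sup>2"
  proof (intro exI conjI ballI)
    show "negligible {x \<in> Lam. cis (- x) = cis (- a)}"
      using cis_eq_on_Lam_subset[OF a] by (intro negligible_finite) (auto intro: finite_subset)
    fix x assume "x \<in> Lam - {x \<in> Lam. cis (- x) = cis (- a)}"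
    then have "0 < cmod (cis (- x) - cis (- a))" by auto
    then have "exp (real (2 * k) * ln (cmod (cis (- x) - cis (- a)))) = cmod (cis (- x) - cis (- a)) ^ (2 * k)"
      by (simp only: exp_of_nat_mult exp_ln)
    also have "\<dots> = (cmod (poly ([:- cis (- a), 1:] ^ k) (cis (- x))))\<^sup>2"
      by (simp add: norm_power power_mult[symmetric] mult.commute)
    finally show "(cmod (poly ([:- cis (- a), 1:] ^ k) (cis (- x))))\<^sup>2
      \<le> exp (real (2 * k) * ln (cmod (cis (- x) - cis (- a))))" by simp
  next
    show "exp (1 / (2 * pi) * integral Lam (\<lambda>x. real (2 * k) * ln (cmod (cis (- x) - cis (- a)))) - e)
        \<le> (cmod (poly ([:- cis (- a), 1:] ^ k) 0))\<^sup>2"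
      unfolding i using e by (simp add: norm_power)
  qed
qed

section \<open>Real powers of polynomials\<close>

text \<open>Splitting off \<open>2 * k >= \<beta>\<close> powers of the chord leaves a remainder
  \<open>u\<close> that is bounded below, because the chord is at most \<open>|x - a|\<close>. It
  may still tend to plus infinity, which the criterion for functions continuous off a finite set
  permits.\<close>

lemma log_minorized_ln_abs_diff:
  assumes a: "a \<in> Lam"
  shows "log_minorized (\<lambda>x. \<beta> * ln \<bar>x - a\<bar>)"
proof -
  define k where "k = nat \<lceil>\<beta> / 2\<rceil>"
  have k: "\<beta> \<le> real (2 * k)" unfolding k_def by linarith
  define u where "u x = \<beta> * ln \<bar>x - a\<bar> - real (2 * k) * ln (cmod (cis (- x) - cis (- a)))" for x
  have lpi: "0 \<le> ln (2 * pi)" using pi_gt3 by (intro ln_ge_zero) auto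
  have "log_minorized u"
  proof (rule log_minorized_continuous_off_finite[where S = "{x \<in> Lam. cis (- x) = cis (- a)}"])
    fix x assume x: "x \<in> Lam"
    have xa: "\<bar>x - a\<bar> \<le> 2 * pi" using x a by (auto simp: Lam_def)
    show "- (\<bar>\<beta>\<bar> + real (2 * k)) * ln (2 * pi) \<le> u x"
    proof (cases "cis (- x) = cis (- a)")
      \<comment> \<open>The chord is 0 here and its logarithm reads \<open>ln 0 = 0\<close>;
        \<open>x\<close> is either \<open>a\<close> or the opposite endpoint, at distance
        \<open>2 * pi\<close>.\<close>
      case True
      have "- \<bar>\<beta>\<bar> * ln (2 * pi) \<le> \<beta> * ln \<bar>x - a\<bar>"
      proof (cases "x = a")
        case True
        then show ?thesis using lpi by simp
      next
        case False
        then have "\<bar>x - a\<bar> = 2 * pi" using cis_uminus_eq_imp_eq[OF True] xa by force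
        moreover have "- \<bar>\<beta>\<bar> * ln (2 * pi) \<le> \<beta> * ln (2 * pi)"
          using lpi by (intro mult_right_mono) auto
        ultimately show ?thesis by simp
      qed
      moreover have "0 \<le> real (2 * k) * ln (2 * pi)" using lpi by simp
      ultimately show ?thesis using True by (simp add: u_def algebra_simps)
    next
      case False
      then have n: "0 < cmod (cis (- x) - cis (- a))" "0 < \<bar>x - a\<bar>" by auto
      have 1: "ln (cmod (cis (- x) - cis (- a))) \<le> ln \<bar>x - a\<bar>"
        using n norm_cis_diff_le[of x a] by (subst ln_le_cancel_iff) auto
      have 2: "ln \<bar>x - a\<bar> \<le> ln (2 * pi)"
        using n xa by (subst ln_le_cancel_iff) auto
      have "- (\<bar>\<beta>\<bar> + real (2 * k)) * ln (2 * pi) \<le> (\<beta> - real (2 * k)) * ln (2 * pi)"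
        using lpi by (intro mult_right_mono) auto
      also have "\<dots> \<le> (\<beta> - real (2 * k)) * ln \<bar>x - a\<bar>"
        using k 2 by (intro mult_left_mono_neg) auto
      also have "\<dots> = \<beta> * ln \<bar>x - a\<bar> - real (2 * k) * ln \<bar>x - a\<bar>"
        by (simp add: algebra_simps)
      also have "\<dots> \<le> u x"
        unfolding u_def by (intro diff_left_mono mult_left_mono 1) auto
      finally show ?thesis .
    qed
  next
    show "u absolutely_integrable_on Lam"
      unfolding u_def
      using absolutely_integrable_scaleR_left[OF absolutely_integrable_ln_norm_cis_diff[OF a], of "real (2 * k)"]
        absolutely_integrable_scaleR_left[OF absolutely_integrable_ln_abs[of a], of \<beta>]
      by (intro set_integral_diff) simp_all
    show "finite {x \<in> Lam. cis (- x) = cis (- a)}"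
      using cis_eq_on_Lam_subset[OF a] by (auto intro: finite_subset)
    fix x assume "x \<in> Lam - {x \<in> Lam. cis (- x) = cis (- a)}"
    then have "x \<noteq> a" "cis (- x) \<noteq> cis (- a)" by auto
    moreover have "isCont (\<lambda>x. cis (- x)) x"
      using continuous_on_eq_continuous_at[of UNIV "\<lambda>x. cis (- x)"] continuous_on_cis[of UNIV uminus]
      by (simp add: continuous_on_minus)
    ultimately show "continuous (at x) u"
      unfolding u_def by (intro continuous_intros) auto
  qed
  from log_minorized_add[OF this log_minorized_ln_norm_cis_diff[OF a, of k]]
  show ?thesis by (simp add: u_def)
qed

text \<open>Roots in \<open>Lam\<close> are split off one at a time. The remaining factor has a
  continuous logarithm on \<open>Lam\<close>, but its values at the two endpoints may differ, so the
  criterion for functions on an interval is used instead of the one on the circle.\<close>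

lemma log_minorized_ln_abs_poly:
  fixes q :: "real poly"
  assumes "q \<noteq> 0"
  shows "log_minorized (\<lambda>x. \<beta> * ln \<bar>poly q x\<bar>)"
  using assms
proof (induction "degree q" arbitrary: q rule: less_induct)
  case less
  show ?case
  proof (cases "\<exists>a\<in>Lam. poly q a = 0")
    case True
    then obtain a where a: "a \<in> Lam" "poly q a = 0" by auto
    then obtain p where q: "q = [:- a, 1:] * p" by (auto simp: poly_eq_0_iff_dvd elim: dvdE)
    then have p: "p \<noteq> 0" using less.prems by auto
    have "degree q = Suc (degree p)"
      unfolding q using p by (subst degree_mult_eq) auto
    then have "log_minorized (\<lambda>x. \<beta> * ln \<bar>poly p x\<bar>)" using less.hyps p by simp
    from log_minorized_add[OF log_minorized_ln_abs_diff[OF a(1), of \<beta>] this]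
    show ?thesis
    proof (rule log_minorized_spike)
      show "negligible {x. poly q x = 0}"
        using less.prems poly_roots_finite by (intro negligible_finite) blast
      fix x assume "x \<in> Lam - {x. poly q x = 0}"
      then have "\<bar>x - a\<bar> > 0" "\<bar>poly p x\<bar> > 0" by (auto simp: q)
      moreover have "\<bar>poly q x\<bar> = \<bar>x - a\<bar> * \<bar>poly p x\<bar>"
        by (simp add: q abs_mult[symmetric] algebra_simps)
      ultimately show "\<beta> * ln \<bar>poly q x\<bar> = \<beta> * ln \<bar>x - a\<bar> + \<beta> * ln \<bar>poly p x\<bar>"
        by (simp add: ln_mult_pos distrib_left)
    qed
  next
    case False
    then have ne: "x \<in> Lam \<Longrightarrow> poly q x \<noteq> 0" for x by auto
    have cont: "continuous_on Lam (\<lambda>x. \<beta> * ln \<bar>poly q x\<bar>)"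
      by (intro continuous_intros) (use ne in auto)
    then obtain c where c: "\<And>x. x \<in> Lam \<Longrightarrow> c \<le> \<beta> * ln \<bar>poly q x\<bar>"
      using continuous_attains_inf[OF compact_Lam Lam_nonempty cont] by blast
    show ?thesis
    proof (rule log_minorized_continuous_off_finite[of c _ "{}"])
      show "(\<lambda>x. \<beta> * ln \<bar>poly q x\<bar>) absolutely_integrable_on Lam"
        by (rule continuous_imp_absolutely_integrable_on_Lam[OF cont])
      fix x assume "x \<in> Lam - {}"
      then show "continuous (at x) (\<lambda>x. \<beta> * ln \<bar>poly q x\<bar>)"
        using ne by (intro continuous_intros) auto
    qed (use c in auto)
  qed
qed

section \<open>The limit of the ratio of prediction errors\<close>

lemma G_pos_iff: "0 < G h \<longleftrightarrow> lnL1 h"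
  by (simp add: G_def)

lemma G_eq_0_iff: "G h = 0 \<longleftrightarrow> \<not> lnL1 h"
  by (simp add: G_def)

text \<open>Used in contraposition: it carries \<open>G f = 0\<close> over to the product
  \<open>f g\<close>.\<close>

lemma lnL1_cancel_mult:
  assumes fg: "lnL1 (\<lambda>x. f x * g x)" and g: "lnL1 g"
    and nonneg: "\<forall>x\<in>Lam. 0 \<le> f x" "\<forall>x\<in>Lam. 0 \<le> g x"
  shows "lnL1 f"
proof -
  let ?N = "{x \<in> Lam. f x * g x \<le> 0}"
  have N: "negligible ?N"
    using fg by (simp add: lnL1_def negligible_iff_null_sets)
  have pos: "0 < f x" "0 < g x" if "x \<in> Lam - ?N" for x
    using that nonneg by (auto simp: not_le zero_less_mult_iff)
  have "{x \<in> Lam. f x \<le> 0} \<subseteq> ?N"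
    using nonneg by (auto simp: mult_nonpos_nonneg)
  then have "negligible {x \<in> Lam. f x \<le> 0}"
    using N by (rule negligible_subset[rotated])
  moreover have "(\<lambda>x. ln (f x)) absolutely_integrable_on Lam"
  proof (rule absolutely_integrable_spike[OF _ N])
    show "(\<lambda>x. ln (f x * g x) - ln (g x)) absolutely_integrable_on Lam"
      using fg g by (intro set_integral_diff) (auto simp: lnL1_def)
    show "ln (f x) = ln (f x * g x) - ln (g x)" if "x \<in> Lam - ?N" for x
      using pos[OF that] by (simp add: ln_mult_pos)
  qed
  ultimately show ?thesis
    by (simp add: lnL1_def negligible_iff_null_sets)
qed

theorem mult_classF_classM:
  assumes f: "f \<in> classF"
    and g: "\<forall>x\<in>Lam. 0 \<le> g x" "L1 (\<lambda>x. f x * g x)" "lnL1 g"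
    and lo: "log_minorized (\<lambda>x. ln (g x))" and up: "log_minorized (\<lambda>x. - ln (g x))"
  shows "(\<lambda>x. f x * g x) \<in> classF" "g \<in> classM f"
proof -
  define a where "a = sigma2 f"
  define b where "b = sigma2 (\<lambda>x. f x * g x)"
  have f1: "f absolutely_integrable_on Lam" "\<forall>x\<in>Lam. 0 \<le> f x" "G f = 0"
    and fs: "(\<lambda>n. sigma f (Suc n) / sigma f n) \<longlonglongrightarrow> 1"
    using f by (auto simp: classF_def L1_def)
  have fg: "(\<lambda>x. f x * g x) absolutely_integrable_on Lam" "\<forall>x\<in>Lam. 0 \<le> f x * g x"
    using g f1 by (auto simp: L1_def)
  have a0: "0 \<le> a n" for n unfolding a_def by (rule sigma2_nonneg[OF f1(1,2)])
  have b0: "0 \<le> b n" for n unfolding b_def by (rule sigma2_nonneg[OF fg])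
  \<comment> \<open>A limit 1 excludes that the ratios are eventually 0, the value of a quotient by
    0. So \<open>a m\<close> is nonzero for some \<open>m >= n\<close>, and \<open>a\<close> is
    decreasing.\<close>
  have apos: "0 < a n" for n
  proof -
    have "eventually (\<lambda>m. 0 < sigma f (Suc m) / sigma f m) sequentially"
      by (rule order_tendstoD[OF fs]) simp
    then obtain m where "m \<ge> n" "0 < sigma f (Suc m) / sigma f m"
      unfolding eventually_sequentially by (meson nat_le_linear order_refl le_trans)
    then have "a m \<noteq> 0" by (auto simp: sigma_def a_def)
    moreover have "a m \<le> a n"
      using sigma2_antimono[OF f1(1,2), of n "m - n"] \<open>m \<ge> n\<close> by (simp add: a_def)
    ultimately show ?thesis using a0[of m] by linarith
  qed
  have ratio: "(\<lambda>n. a (Suc n) / a n) \<longlonglongrightarrow> 1"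
  proof -
    have "(\<lambda>n. (sigma f (Suc n) / sigma f n)\<^sup>2) \<longlonglongrightarrow> 1\<^sup>2"
      by (intro tendsto_power fs)
    then show ?thesis
      using a0 by (simp add: sigma_def power_divide a_def)
  qed
  \<comment> \<open>Zeros of \<open>g\<close> are discarded because \<open>exp (ln 0) = 1\<close>
    there, so bounds by \<open>exp (ln (g x))\<close> say nothing about \<open>g x\<close>.\<close>
  let ?N = "{x \<in> Lam. g x \<le> 0}"
  have N: "negligible ?N" using g(3) by (simp add: lnL1_def negligible_iff_null_sets)
  have Gpos: "0 < G g" using g(3) by (simp add: G_pos_iff)
  have Gg: "G g = exp (1 / (2 * pi) * integral Lam (\<lambda>x. ln (g x)))"
    using g(3) by (simp add: G_def)
  have lim: "(\<lambda>n. b n / a n) \<longlonglongrightarrow> G g"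
  proof (rule tendsto_ratio_squeeze[OF ratio apos Gpos])
    fix e :: real assume e: "0 < e"
    obtain P M where P: "negligible M"
      "\<And>x. x \<in> Lam - M \<Longrightarrow> (cmod (poly P (cis (- x))))\<^sup>2 \<le> exp (ln (g x))"
      "exp (1 / (2 * pi) * integral Lam (\<lambda>x. ln (g x)) - e) \<le> (cmod (poly P 0))\<^sup>2"
      using log_minorizedE[OF lo e] by metis
    show "\<exists>p d. G g * exp (- e) \<le> p \<and> (\<forall>n. p * a (n + d) \<le> b n)"
    proof (intro exI conjI allI)
      show "G g * exp (- e) \<le> (cmod (poly P 0))\<^sup>2"
        using P(3) unfolding Gg exp_add[symmetric] by simp
      show "(cmod (poly P 0))\<^sup>2 * a (n + degree P) \<le> b n" for n
        unfolding a_def b_def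
      proof (rule sigma2_mult_poly_le[OF f1(1,2) fg])
        show "negligible (M \<union> ?N)" using P(1) N by auto
        fix x assume x: "x \<in> Lam - (M \<union> ?N)"
        then have "(cmod (poly P (cis (- x))))\<^sup>2 \<le> g x" using P(2)[of x] by auto
        from mult_right_mono[OF this, of "f x"] x f1(2)
        show "(cmod (poly P (cis (- x))))\<^sup>2 * f x \<le> f x * g x" by (auto simp: mult.commute)
      qed simp
    qed
    obtain P M where P: "negligible M"
      "\<And>x. x \<in> Lam - M \<Longrightarrow> (cmod (poly P (cis (- x))))\<^sup>2 \<le> exp (- ln (g x))"
      "exp (1 / (2 * pi) * integral Lam (\<lambda>x. - ln (g x)) - e) \<le> (cmod (poly P 0))\<^sup>2"
      using log_minorizedE[OF up e] by metis
    show "\<exists>p d. exp (- e) / G g \<le> p \<and> (\<forall>n. p * b (n + d) \<le> a n)"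
    proof (intro exI conjI allI)
      have "exp (- e) / G g = exp (1 / (2 * pi) * integral Lam (\<lambda>x. - ln (g x)) - e)"
        unfolding Gg exp_diff[symmetric] by simp
      then show "exp (- e) / G g \<le> (cmod (poly P 0))\<^sup>2"
        using P(3) by simp
      show "(cmod (poly P 0))\<^sup>2 * b (n + degree P) \<le> a n" for n
        unfolding a_def b_def
      proof (rule sigma2_mult_poly_le[OF fg f1(1,2)])
        show "negligible (M \<union> ?N)" using P(1) N by auto
        fix x assume x: "x \<in> Lam - (M \<union> ?N)"
        then have gx: "0 < g x" by auto
        have "(cmod (poly P (cis (- x))))\<^sup>2 \<le> 1 / g x"
          using P(2)[of x] x gx by (simp add: exp_minus divide_inverse)
        from mult_right_mono[OF this, of "f x * g x"] x fg(2) gx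
        show "(cmod (poly P (cis (- x))))\<^sup>2 * (f x * g x) \<le> f x" by auto
      qed simp
    qed
  qed
  then show "g \<in> classM f"
    using g Gpos by (simp add: classM_def a_def b_def)
  have "\<not> lnL1 (\<lambda>x. f x * g x)"
    using lnL1_cancel_mult[OF _ g(3) f1(2) g(1)] f1(3) by (auto simp: G_eq_0_iff)
  then have "G (\<lambda>x. f x * g x) = 0" by (simp add: G_eq_0_iff)
  moreover have "(\<lambda>n. sqrt (b (Suc n) / b n)) \<longlonglongrightarrow> sqrt 1"
  proof (rule tendsto_real_sqrt)
    \<comment> \<open>Since \<open>b / a\<close> converges to a positive limit, the ratios of
      \<open>b\<close> inherit the limit 1 from those of \<open>a\<close>.\<close>
    have lim1: "(\<lambda>n. (b (Suc n) / a (Suc n)) * (a (Suc n) / a n) / (b n / a n)) \<longlonglongrightarrow> G g * 1 / G g"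
      using Gpos by (intro tendsto_intros lim ratio LIMSEQ_Suc[OF lim]) auto
    have eq: "(b (Suc n) / a (Suc n)) * (a (Suc n) / a n) / (b n / a n) = b (Suc n) / b n" for n
      using apos[of n] apos[of "Suc n"] by simp
    show "(\<lambda>n. b (Suc n) / b n) \<longlonglongrightarrow> 1" using lim1 Gpos unfolding eq by simp
  qed
  ultimately show "(\<lambda>x. f x * g x) \<in> classF"
    using fg by (simp add: classF_def L1_def sigma_def b_def real_sqrt_divide)
qed

theorem mainTheorem15:
  fixes f h :: "real \<Rightarrow> real" and q :: "real poly" and \<alpha> :: real
  assumes "f \<in> classF"
    and "h \<in> classBpm"
    and "q \<noteq> 0"
    and "L1 (\<lambda>l. f l * (h l * \<bar>poly q l\<bar> powr \<alpha>))"
  shows "(\<lambda>l. f l * (h l * \<bar>poly q l\<bar> powr \<alpha>)) \<in> classF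
       \<and> (\<lambda>l. h l * \<bar>poly q l\<bar> powr \<alpha>) \<in> classM f
       \<and> (\<lambda>n. sigma2 (\<lambda>l. f l * (h l * \<bar>poly q l\<bar> powr \<alpha>)) n / sigma2 f n)
            \<longlonglongrightarrow> G (\<lambda>l. h l * \<bar>poly q l\<bar> powr \<alpha>)"
proof -
  define g where "g l = h l * \<bar>poly q l\<bar> powr \<alpha>" for l
  obtain m where m: "0 < m" "\<And>x. x \<in> Lam \<Longrightarrow> m \<le> h x"
    using assms(2) by (auto simp: classBpm_def)
  have h0: "0 < h x" if "x \<in> Lam" for x using m(1) m(2)[OF that] by simp
  \<comment> \<open>At a root \<open>0 powr \<alpha> = 0\<close> for every \<open>\<alpha>\<close>,
    even a negative one, and the formula for \<open>ln g\<close> need not hold; there are finitely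
    many roots.\<close>
  let ?N = "{x. poly q x = 0}"
  have N: "negligible ?N"
    using assms(3) poly_roots_finite by (intro negligible_finite) blast
  have g0: "0 < g x" if "x \<in> Lam - ?N" for x
    using h0[of x] that by (simp add: g_def)
  have ln_g: "ln (g x) = ln (h x) + \<alpha> * ln \<bar>poly q x\<bar>" if "x \<in> Lam - ?N" for x
    using h0[of x] that by (simp add: g_def ln_mult_pos ln_powr)
  have lo: "log_minorized (\<lambda>x. ln (g x))"
    using log_minorized_add[OF log_minorized_ln_classBpm[OF assms(2)] log_minorized_ln_abs_poly[OF assms(3), of \<alpha>]]
    by (rule log_minorized_spike[OF _ N ln_g])
  \<comment> \<open>The reciprocal weight has the same shape, with \<open>1 / h\<close> in place of
    \<open>h\<close> and \<open>- \<alpha>\<close> in place of \<open>\<alpha>\<close>.\<close>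
  have up: "log_minorized (\<lambda>x. - ln (g x))"
    using log_minorized_add[OF log_minorized_uminus_ln_classBpm[OF assms(2)] log_minorized_ln_abs_poly[OF assms(3), of "- \<alpha>"]]
    by (rule log_minorized_spike[OF _ N]) (simp add: ln_g)
  have "{x \<in> Lam. g x \<le> 0} \<subseteq> ?N" using g0 by force
  then have "lnL1 g"
    using log_minorized_integrable(1)[OF lo] negligible_subset[OF N]
    by (simp add: lnL1_def negligible_iff_null_sets[symmetric])
  moreover have "\<forall>x\<in>Lam. 0 \<le> g x" using h0 by (simp add: g_def less_imp_le)
  moreover have "L1 (\<lambda>x. f x * g x)" using assms(4) by (simp add: g_def)
  ultimately have "(\<lambda>x. f x * g x) \<in> classF" "g \<in> classM f"
    using mult_classF_classM[OF assms(1)] lo up by blast+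
  then show ?thesis by (simp add: classM_def g_def[abs_def])
qed

end
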